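(* Let $(X,T)$ be a dynamical system with $X$ infinite. If $(X,T)$ is transitive and has the shadowing property, then the set of non-atomic ergodic measures is residual in $M_T(X)$.
   Context: A dynamical system $(X,T)$ is a compact metric space $(X,d)$ with a continuous map $T\colon X\to X$ (not necessarily invertible). It is transitive if for any two nonempty open sets $U,V\subset X$ there is $n>0$ with $T^n(U)\cap V\neq\emptyset$. A sequence $(x_n)_{n=0}^\infty$ in $X$ is a $\delta$-pseudo-orbit if $d(T(x_n),x_{n+1})<\delta$ for all $n\ge 0$; it is $\varepsilon$-traced by $y\in X$ if $d(T^n(y),x_n)<\varepsilon$ for all $n\ge 0$. $(X,T)$ has the shadowing property if for every $\varepsilon>0$ there is $\delta>0$ such that every $\delta$-pseudo-orbit is $\varepsilon$-traced by some point of $X$. $M_T(X)$ is the space of $T$-invariant Borel probability measures on $X$ with the weak$^*$-topology. A measure is non-atomic if every singleton has measure $0$. Residual means having complement of first category. *)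

theory Defs
  imports "HOL-Probability.Probability"
begin

text \<open>
  The phase space is a compact subset \<open>X\<close> of a metric type, with the induced metric; values of
  \<open>T\<close> outside \<open>X\<close> are irrelevant.
\<close>

definition dynamical_system :: "'a::metric_space set \<Rightarrow> ('a \<Rightarrow> 'a) \<Rightarrow> bool" where
  "dynamical_system X T \<longleftrightarrow> compact X \<and> continuous_on X T \<and> T ` X \<subseteq> X"

definition transitive_system :: "'a::metric_space set \<Rightarrow> ('a \<Rightarrow> 'a) \<Rightarrow> bool" where
  "transitive_system X T \<longleftrightarrow>
     (\<forall>U V. openin (top_of_set X) U \<and> U \<noteq> {} \<and> openin (top_of_set X) V \<and> V \<noteq> {} \<longrightarrow>
        (\<exists>n>0. (T ^^ n) ` U \<inter> V \<noteq> {}))"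

definition pseudo_orbit ::
  "'a::metric_space set \<Rightarrow> ('a \<Rightarrow> 'a) \<Rightarrow> real \<Rightarrow> (nat \<Rightarrow> 'a) \<Rightarrow> bool" where
  "pseudo_orbit X T \<delta> x \<longleftrightarrow> (\<forall>n. x n \<in> X) \<and> (\<forall>n. dist (T (x n)) (x (Suc n)) < \<delta>)"

definition traces :: "('a::metric_space \<Rightarrow> 'a) \<Rightarrow> real \<Rightarrow> 'a \<Rightarrow> (nat \<Rightarrow> 'a) \<Rightarrow> bool" where
  "traces T \<epsilon> y x \<longleftrightarrow> (\<forall>n. dist ((T ^^ n) y) (x n) < \<epsilon>)"

definition shadowing_property :: "'a::metric_space set \<Rightarrow> ('a \<Rightarrow> 'a) \<Rightarrow> bool" where
  "shadowing_property X T \<longleftrightarrow>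
     (\<forall>\<epsilon>>0. \<exists>\<delta>>0. \<forall>x. pseudo_orbit X T \<delta> x \<longrightarrow> (\<exists>y\<in>X. traces T \<epsilon> y x))"

definition invariant_measures :: "'a::metric_space set \<Rightarrow> ('a \<Rightarrow> 'a) \<Rightarrow> 'a measure set" where
  "invariant_measures X T =
     {\<mu>. prob_space \<mu> \<and> sets \<mu> = sets (restrict_space borel X) \<and>
         (\<forall>A\<in>sets \<mu>. emeasure \<mu> (T -` A \<inter> X) = emeasure \<mu> A)}"

text \<open>
  The weak* topology on the invariant measures: the coarsest topology for which integration of
  each continuous real function on \<open>X\<close> is continuous.
\<close>

definition weak_star_topology ::
  "'a::metric_space set \<Rightarrow> ('a \<Rightarrow> 'a) \<Rightarrow> 'a measure topology" where
  "weak_star_topology X T =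
     topology_generated_by
       {{\<mu> \<in> invariant_measures X T. (\<integral>x. f x \<partial>\<mu>) \<in> U} | (f :: 'a \<Rightarrow> real) U.
          continuous_on X f \<and> open U}"

lemma topspace_weak_star_topology [simp]:
  "topspace (weak_star_topology X T) = invariant_measures X T"
proof -
  have "invariant_measures X T \<in>
      {{\<mu> \<in> invariant_measures X T. (\<integral>x. f x \<partial>\<mu>) \<in> U} | (f :: 'a \<Rightarrow> real) U.
          continuous_on X f \<and> open U}"
    by (intro CollectI exI[of _ "\<lambda>_. 0"] exI[of _ UNIV]) auto
  then show ?thesis
    unfolding weak_star_topology_def topology_generated_by_topspace by blast
qed

definition ergodic_measures :: "'a::metric_space set \<Rightarrow> ('a \<Rightarrow> 'a) \<Rightarrow> 'a measure set" where
  "ergodic_measures X T =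
     {\<mu> \<in> invariant_measures X T.
        \<forall>A\<in>sets \<mu>. T -` A \<inter> X = A \<longrightarrow> emeasure \<mu> A = 0 \<or> emeasure \<mu> A = 1}"

definition nonatomic_on :: "'a set \<Rightarrow> 'a measure \<Rightarrow> bool" where
  "nonatomic_on X \<mu> \<longleftrightarrow> (\<forall>x\<in>X. emeasure \<mu> {x} = 0)"

definition nowhere_dense_in :: "'a topology \<Rightarrow> 'a set \<Rightarrow> bool" where
  "nowhere_dense_in S A \<longleftrightarrow> A \<subseteq> topspace S \<and> S interior_of (S closure_of A) = {}"

definition first_category_in :: "'a topology \<Rightarrow> 'a set \<Rightarrow> bool" where
  "first_category_in S A \<longleftrightarrow>
     (\<exists>\<N>. countable \<N> \<and> (\<forall>N\<in>\<N>. nowhere_dense_in S N) \<and> A = \<Union>\<N>)"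

definition residual_in :: "'a topology \<Rightarrow> 'a set \<Rightarrow> bool" where
  "residual_in S A \<longleftrightarrow> A \<subseteq> topspace S \<and> first_category_in S (topspace S - A)"

end

theory Submission
  imports Defs
begin

text \<open>
  Write \<open>A\<^sub>n f\<close> for the Birkhoff averages of \<open>f\<close>. If \<open>A\<close> is an invariant set of intermediate measure,
  a continuous \<open>f\<close> close to the indicator of \<open>A\<close> in \<open>L\<^sup>1\<close> has \<open>Var(A\<^sub>n f)\<close> bounded away from \<open>0\<close>
  uniformly in \<open>n\<close>. So the non-ergodic measures lie in countably many closed sets of the form
  \<open>Var(A\<^sub>n f) \<ge> 1/m\<close> for all \<open>n\<close>, and the measures with atoms in countably many closed sets cut out
  by bump functions. It remains to find, near every invariant measure, an invariant \<open>\<nu>\<close> for which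
  some \<open>A\<^sub>N f\<close> is nearly constant almost everywhere and all atoms are small.

  Transitivity gives a periodic pseudo-orbit whose empirical measure is near the given measure and
  which passes through a point without small period. If \<open>y\<close> shadows a pseudo-orbit of period \<open>N\<close>, then
  by compactness two points \<open>T\<^bsup>iN\<^esup> y\<close>, \<open>T\<^bsup>jN\<^esup> y\<close> are as close as we like, and the orbit segment between
  them is a much finer periodic pseudo-orbit that stays uniformly close to the old one. Iterating
  gives an equivariant map from an odometer to \<open>X\<close>, and \<open>\<nu>\<close> is the image of its Haar measure.
\<close>

section \<open>Preliminaries on the weak* topology\<close>

text \<open>Shadowing alone provides no periodic points: an infinite odometer is transitive, has the
  shadowing property and has none. So a point that shadows a cycle cannot be taken periodic, and the
  approximating measures have to come from odometers instead of periodic orbits. Almost every point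
  of \<open>\<nu>\<close> follows one and the same cycle of length \<open>N\<close>, only at a
  different phase, and a sum over a full period does not see the phase; this is why
  \<open>bavg N f\<close> is nearly one constant. Such a \<open>\<nu>\<close> may still sit on a
  finite orbit. Its atoms are small nevertheless, because the cycle runs through a long orbit
  segment of a point without small period, and an eventually periodic orbit of small period cannot
  stay close to that segment. Variances enter because ergodicity speaks about all measurable sets,
  whereas for fixed \<open>n\<close> the variance of \<open>bavg n f\<close> is a combination of
  integrals of continuous functions. The map may fail to be invertible, so only forward orbits are
  followed, and invariance gives merely an inequality between the masses of \<open>x\<close> and
  \<open>T x\<close>.\<close>

locale compact_dynamics =
  fixes X :: "'a::metric_space set" and T :: "'a \<Rightarrow> 'a"
  assumes compact_space: "compact X"
    and continuous_T: "continuous_on X T"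
    and T_into: "\<And>x. x \<in> X \<Longrightarrow> T x \<in> X"
begin

abbreviation MX :: "'a measure set" where "MX \<equiv> invariant_measures X T"

definition bavg :: "nat \<Rightarrow> ('a \<Rightarrow> real) \<Rightarrow> 'a \<Rightarrow> real" where
  "bavg n f x = (\<Sum>i<n. f ((T ^^ i) x)) / real n"

lemma funpow_into: "x \<in> X \<Longrightarrow> (T ^^ n) x \<in> X"
  by (induction n) (auto intro: T_into)

lemma continuous_funpow: "continuous_on X (T ^^ n)"
proof (induction n)
  case (Suc n)
  have "continuous_on X (T \<circ> (T ^^ n))"
    by (rule continuous_on_compose[OF Suc])
      (rule continuous_on_subset[OF continuous_T], auto intro: funpow_into)
  then show ?case by simp
qed (simp add: id_def)

lemma continuous_bavg: "continuous_on X f \<Longrightarrow> continuous_on X (bavg n f)"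
  unfolding bavg_def divide_inverse
  by (intro continuous_intros continuous_on_compose2[OF _ continuous_funpow])
    (auto intro: funpow_into)

lemma MX_D:
  assumes "\<mu> \<in> MX"
  shows "prob_space \<mu>" "sets \<mu> = sets (restrict_space borel X)" "space \<mu> = X"
    "\<And>A. A \<in> sets \<mu> \<Longrightarrow> emeasure \<mu> (T -` A \<inter> X) = emeasure \<mu> A"
  using assms sets_eq_imp_space_eq[of \<mu> "restrict_space borel X"]
  by (auto simp: invariant_measures_def space_restrict_space)

lemma measurable_continuous:
  assumes "sets \<mu> = sets (restrict_space borel X)" "continuous_on X (f :: 'a \<Rightarrow> 'b::topological_space)"
  shows "f \<in> borel_measurable \<mu>"
  using borel_measurable_continuous_on_restrict[OF assms(2)]
  unfolding measurable_cong_sets[OF assms(1) refl] .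

lemma bounded_continuous:
  assumes "continuous_on X (f :: 'a \<Rightarrow> real)"
  obtains B where "B > 0" "\<And>x. x \<in> X \<Longrightarrow> \<bar>f x\<bar> \<le> B"
  using compact_imp_bounded[OF compact_continuous_image[OF assms compact_space]]
  unfolding bounded_pos by auto

lemma integrable_continuous:
  assumes "prob_space \<mu>" "sets \<mu> = sets (restrict_space borel X)" "continuous_on X (f :: 'a \<Rightarrow> real)"
  shows "integrable \<mu> f"
proof -
  interpret prob_space \<mu> by fact
  have sp: "space \<mu> = X"
    using sets_eq_imp_space_eq[OF assms(2)] by (simp add: space_restrict_space)
  obtain B where B: "\<And>x. x \<in> X \<Longrightarrow> \<bar>f x\<bar> \<le> B"
    using bounded_continuous[OF assms(3)] by blast
  show ?thesis
    using B measurable_continuous[OF assms(2,3)]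
    by (intro integrable_const_bound[of _ B] AE_I2) (simp_all add: sp)
qed

lemma measurable_T:
  assumes "sets \<mu> = sets (restrict_space borel X)"
  shows "T \<in> measurable \<mu> \<mu>"
proof -
  have "T \<in> measurable (restrict_space borel X) (restrict_space borel X)"
    by (rule measurable_restrict_space2)
      (auto simp: space_restrict_space T_into intro: borel_measurable_continuous_on_restrict[OF continuous_T])
  then show ?thesis unfolding measurable_cong_sets[OF assms assms] .
qed

lemma distr_T:
  assumes "\<mu> \<in> MX" shows "distr \<mu> \<mu> T = \<mu>"
proof (rule measure_eqI)
  show "emeasure (distr \<mu> \<mu> T) A = emeasure \<mu> A" if "A \<in> sets (distr \<mu> \<mu> T)" for A
    using that emeasure_distr[OF measurable_T[OF MX_D(2)[OF assms]], of A] MX_D(3,4)[OF assms] by simp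
qed simp

lemma integrable_compose_T:
  fixes g :: "'a \<Rightarrow> real"
  assumes "\<mu> \<in> MX" "integrable \<mu> g"
  shows "integrable \<mu> (\<lambda>x. g (T x))"
proof -
  have "integrable (distr \<mu> \<mu> T) g" using assms by (simp add: distr_T)
  then show ?thesis
    by (rule integrable_distr[OF measurable_T[OF MX_D(2)[OF assms(1)]]])
qed

lemma integral_compose_T:
  fixes g :: "'a \<Rightarrow> real"
  assumes "\<mu> \<in> MX" "integrable \<mu> g"
  shows "(\<integral>x. g (T x) \<partial>\<mu>) = (\<integral>x. g x \<partial>\<mu>)"
  using integral_distr[OF measurable_T[OF MX_D(2)[OF assms(1)]] borel_measurable_integrable[OF assms(2)]]
  by (simp add: distr_T assms(1))

lemma integral_compose_funpow:
  fixes g :: "'a \<Rightarrow> real"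
  assumes "\<mu> \<in> MX" "integrable \<mu> g"
  shows "integrable \<mu> (\<lambda>x. g ((T ^^ n) x)) \<and> (\<integral>x. g ((T ^^ n) x) \<partial>\<mu>) = (\<integral>x. g x \<partial>\<mu>)"
proof (induction n)
  case (Suc n)
  have "(T ^^ n) (T x) = T ((T ^^ n) x)" for x
    by (simp add: funpow_swap1)
  then show ?case
    using integrable_compose_T[OF assms(1), of "\<lambda>x. g ((T ^^ n) x)"]
      integral_compose_T[OF assms(1), of "\<lambda>x. g ((T ^^ n) x)"] Suc by simp
qed (use assms in simp)

lemma integral_bavg:
  assumes "\<mu> \<in> MX" "integrable \<mu> g" "n > 0"
  shows "integrable \<mu> (bavg n g)" "(\<integral>x. bavg n g x \<partial>\<mu>) = (\<integral>x. g x \<partial>\<mu>)"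
  using assms(3) integral_compose_funpow[OF assms(1,2)]
  unfolding bavg_def by (auto simp: field_simps)

lemma continuous_map_integral:
  assumes "continuous_on X (f :: 'a \<Rightarrow> real)"
  shows "continuous_map (weak_star_topology X T) euclideanreal (\<lambda>\<mu>. \<integral>x. f x \<partial>\<mu>)"
  unfolding continuous_map_def
proof (intro conjI allI impI)
  fix U :: "real set" assume "openin euclideanreal U"
  then have "open U" by simp
  then show "openin (weak_star_topology X T) {\<mu> \<in> topspace (weak_star_topology X T). (\<integral>x. f x \<partial>\<mu>) \<in> U}"
    unfolding topspace_weak_star_topology unfolding weak_star_topology_def
    using assms by (intro topology_generated_by_Basis CollectI exI[of _ f] exI[of _ U]) simp
qed simp

text \<open>Finitely many integrals and one common radius give a neighbourhood base: for an
  intersection the two families are united and the smaller radius is kept. Density arguments then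
  only have to match finitely many integrals.\<close>

lemma weak_star_neighbourhood:
  assumes "openin (weak_star_topology X T) W" "\<mu> \<in> W"
  obtains F \<epsilon> where "finite F" "\<And>f. f \<in> F \<Longrightarrow> continuous_on X f" "\<epsilon> > (0::real)"
    "\<And>\<nu>. \<nu> \<in> MX \<Longrightarrow> (\<And>f. f \<in> F \<Longrightarrow> \<bar>(\<integral>x. f x \<partial>\<nu>) - (\<integral>x. f x \<partial>\<mu>)\<bar> < \<epsilon>) \<Longrightarrow> \<nu> \<in> W"
proof -
  define B where "B = {{\<mu> \<in> MX. (\<integral>x. f x \<partial>\<mu>) \<in> U} | (f :: 'a \<Rightarrow> real) U. continuous_on X f \<and> open U}"
  define nb where "nb F \<epsilon> = {\<nu> \<in> MX. \<forall>f\<in>F. \<bar>(\<integral>x. f x \<partial>\<nu>) - (\<integral>x. f x \<partial>\<mu>)\<bar> < \<epsilon>}" for F :: "('a \<Rightarrow> real) set" and \<epsilon>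
  define good where "good F \<epsilon> \<longleftrightarrow> finite F \<and> (\<forall>f\<in>F. continuous_on X f) \<and> \<epsilon> > (0::real)" for F :: "('a \<Rightarrow> real) set" and \<epsilon>
  have "generate_topology_on B W"
    using assms(1) unfolding weak_star_topology_def B_def openin_topology_generated_by_iff .
  then have "\<exists>F \<epsilon>. good F \<epsilon> \<and> nb F \<epsilon> \<subseteq> W"
    using assms(2)
  proof (induction rule: generate_topology_on.induct)
    case (Int a b)
    have "\<mu> \<in> a" "\<mu> \<in> b" using Int.prems by auto
    from Int.IH(1)[OF this(1)] Int.IH(2)[OF this(2)]
    obtain F \<epsilon> G \<eta> where *: "good F \<epsilon>" "nb F \<epsilon> \<subseteq> a" "good G \<eta>" "nb G \<eta> \<subseteq> b"
      by blast
    have "nb (F \<union> G) (min \<epsilon> \<eta>) \<subseteq> nb F \<epsilon> \<inter> nb G \<eta>"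
      unfolding nb_def by auto
    moreover have "good (F \<union> G) (min \<epsilon> \<eta>)"
      using * unfolding good_def by auto
    ultimately show ?case using *(2,4) by blast
  next
    case (UN K)
    then obtain k where k: "k \<in> K" "\<mu> \<in> k" by blast
    from UN.IH[OF k] obtain F \<epsilon> where "good F \<epsilon>" "nb F \<epsilon> \<subseteq> k" by blast
    with k(1) show ?case by blast
  next
    case (Basis s)
    from Basis(1) obtain f :: "'a \<Rightarrow> real" and U where s: "s = {\<mu> \<in> MX. (\<integral>x. f x \<partial>\<mu>) \<in> U}" "continuous_on X f" "open U"
      unfolding B_def by blast
    then have "(\<integral>x. f x \<partial>\<mu>) \<in> U" using Basis by simp
    with s(3) obtain \<epsilon> where "\<epsilon> > 0" "ball (\<integral>x. f x \<partial>\<mu>) \<epsilon> \<subseteq> U"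
      using open_contains_ball by blast
    then have "good {f} \<epsilon>" "nb {f} \<epsilon> \<subseteq> s"
      using s by (auto simp: good_def nb_def subset_eq dist_real_def abs_minus_commute)
    then show ?case by blast
  qed simp
  then obtain F \<epsilon> where F: "good F \<epsilon>" "nb F \<epsilon> \<subseteq> W" by blast
  show thesis
  proof (rule that)
    show "\<nu> \<in> W" if "\<nu> \<in> MX" "\<And>f. f \<in> F \<Longrightarrow> \<bar>(\<integral>x. f x \<partial>\<nu>) - (\<integral>x. f x \<partial>\<mu>)\<bar> < \<epsilon>" for \<nu>
      using that F(2) by (auto simp: nb_def)
  qed (use F(1) in \<open>auto simp: good_def\<close>)
qed

end

section \<open>Approximation of indicators by continuous functions\<close>

lemma closed_indicator_approx:
  fixes K :: "'a::metric_space set"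
  assumes "closed K" "K \<noteq> {}"
  shows "(\<lambda>n. max 0 (1 - real n * infdist x K)) \<longlonglongrightarrow> indicator K x"
proof (cases "x \<in> K")
  case False
  then have pos: "infdist x K > 0"
    using assms in_closed_iff_infdist_zero infdist_nonneg by (metis less_eq_real_def)
  obtain m where m: "1 / infdist x K < real m" using reals_Archimedean2 by blast
  have "max 0 (1 - real n * infdist x K) = 0" if "n \<ge> m" for n
  proof -
    have "1 < real m * infdist x K" using m pos by (simp add: field_simps)
    also have "\<dots> \<le> real n * infdist x K" using that pos by (intro mult_right_mono) auto
    finally show ?thesis by simp
  qed
  then have "eventually (\<lambda>n. max 0 (1 - real n * infdist x K) = 0) sequentially"
    using eventually_sequentially by blast
  then show ?thesis using False by (simp add: tendsto_eventually)
qed (simp add: infdist_zero)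

text \<open>Dynkin's pi-lambda theorem for the intersection-stable family of closed sets.
  Disjointness in the union case is what makes indicators and measures add up.\<close>

lemma borel_induct_closed [consumes 1, case_names closed compl union]:
  assumes "B \<in> sets (borel :: 'a::topological_space measure)"
    and "\<And>K :: 'a set. closed K \<Longrightarrow> P K"
    and "\<And>A. A \<in> sets borel \<Longrightarrow> P A \<Longrightarrow> P (- A)"
    and "\<And>A :: nat \<Rightarrow> 'a set. disjoint_family A \<Longrightarrow> (\<And>i. A i \<in> sets borel) \<Longrightarrow> (\<And>i. P (A i)) \<Longrightarrow> P (\<Union>i. A i)"
  shows "P B"
proof -
  have eq: "sets (borel :: 'a measure) = sigma_sets UNIV (Collect closed)"
    by (subst borel_eq_closed) (auto simp: sets_measure_of)
  have B: "B \<in> sigma_sets UNIV (Collect closed)" using assms(1) eq by simp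
  have "Int_stable (Collect (closed :: 'a set \<Rightarrow> bool))"
    by (auto simp: Int_stable_def)
  then show ?thesis
  proof (rule sigma_sets_induct_disjoint[OF _ _ B])
    show "P (UNIV - A)" if "A \<in> sigma_sets UNIV (Collect closed)" "P A" for A
      using assms(3)[of A] that unfolding eq Compl_eq_Diff_UNIV by blast
    show "P (\<Union>i. A i)" if "disjoint_family A" "range A \<subseteq> sigma_sets UNIV (Collect closed)" 
      "\<And>i. P (A i)" for A :: "nat \<Rightarrow> 'a set"
      using assms(4)[of A] that unfolding eq by blast
  qed (use assms(2) assms(2)[of "{}"] in auto)
qed

text \<open>The sets whose indicator is an \<open>L\<^sup>1\<close> limit of continuous functions
  with values in the unit interval form a Dynkin system that contains the closed sets.\<close>

lemma indicator_approx_continuous: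
  fixes X :: "'a::metric_space set"
  assumes "prob_space \<mu>" and sets: "sets \<mu> = sets (restrict_space borel X)"
    and "B \<in> sets borel" "\<epsilon> > 0"
  shows "\<exists>f. continuous_on UNIV f \<and> (\<forall>x. f x \<in> {0..1::real}) \<and> (\<integral>x. \<bar>f x - indicator B x\<bar> \<partial>\<mu>) < \<epsilon>"
  using assms(3,4)
proof (induction arbitrary: \<epsilon> rule: borel_induct_closed)
  interpret prob_space \<mu> by fact
  have meas: "f \<in> borel_measurable \<mu>" if "f \<in> borel_measurable borel" for f :: "'a \<Rightarrow> real"
    using measurable_restrict_space1[OF that] unfolding measurable_cong_sets[OF sets refl] .
  {
    case (closed K)
    show ?case
    \<comment> \<open>The empty set is separate because \<open>infdist x {}\<close> is
      \<open>0\<close>, so that the approximants below would be constantly \<open>1\<close>.\<close>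
    proof (cases "K = {}")
      case False
      define f where "f n x = max 0 (1 - real n * infdist x K)" for n x
      have cont: "continuous_on UNIV (f n)" for n
        unfolding f_def by (intro continuous_intros)
      have f01: "f n x \<in> {0..1}" for n x
        unfolding f_def by (auto simp: infdist_nonneg)
      have lim: "(\<lambda>n. f n x) \<longlonglongrightarrow> indicator K x" for x
        unfolding f_def by (rule closed_indicator_approx[OF closed(1) False])
      have [measurable]: "f n \<in> borel_measurable \<mu>" for n
        by (intro meas borel_measurable_continuous_onI cont)
      have [measurable]: "(\<lambda>x. indicator K x :: real) \<in> borel_measurable \<mu>"
        using closed by (intro meas) auto
      have "(\<lambda>n. \<integral>x. \<bar>f n x - indicator K x\<bar> \<partial>\<mu>) \<longlonglongrightarrow> (\<integral>x. 0 \<partial>\<mu>)"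
      proof (rule integral_dominated_convergence[where w = "\<lambda>_. 1"])
        show "AE x in \<mu>. (\<lambda>n. \<bar>f n x - indicator K x\<bar>) \<longlonglongrightarrow> 0"
          using lim
          by (intro AE_I2 tendsto_rabs_zero) (simp add: LIM_zero)
        show "AE x in \<mu>. norm \<bar>f n x - indicator K x\<bar> \<le> 1" for n
          by (intro AE_I2) (use f01[of n] in \<open>auto simp: indicator_def\<close>)
      qed simp_all
      then have "eventually (\<lambda>n. (\<integral>x. \<bar>f n x - indicator K x\<bar> \<partial>\<mu>) < \<epsilon>) sequentially"
        using closed(2) by (intro order_tendstoD) auto
      then obtain n where "(\<integral>x. \<bar>f n x - indicator K x\<bar> \<partial>\<mu>) < \<epsilon>"
        unfolding eventually_sequentially by blast
      then show ?thesis using cont[of n]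
        by (intro exI[of _ "f n"]) (use f01[of n] in auto)
    qed (use closed in \<open>auto intro!: exI[of _ "\<lambda>_. 0"]\<close>)
  next
    case (compl A)
    obtain f where f: "continuous_on UNIV f" "\<forall>x. f x \<in> {0..1::real}" "(\<integral>x. \<bar>f x - indicator A x\<bar> \<partial>\<mu>) < \<epsilon>"
      using compl by blast
    have "\<bar>(1 - f x) - indicator (- A) x\<bar> = \<bar>f x - indicator A x\<bar>" for x
      by (auto simp: indicator_def)
    then show ?case using f
      by (intro exI[of _ "\<lambda>x. 1 - f x"]) (auto intro!: continuous_intros)
  next
    case (union A)
    have [measurable]: "(\<lambda>x. indicator (A i) x :: real) \<in> borel_measurable \<mu>" for i
      using union(2) by (intro meas) auto
    have [measurable]: "(\<lambda>x. indicator (\<Union>i. A i) x :: real) \<in> borel_measurable \<mu>"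
      using union(2) by (intro meas) auto
    have lim: "(\<lambda>n. \<Sum>i<n. indicator (A i) x :: real) \<longlonglongrightarrow> indicator (\<Union>i. A i) x" for x
      using indicator_sums[of A x] union(1)
      by (simp add: sums_def disjoint_family_on_def)
    have le1: "(\<Sum>i<n. indicator (A i) x :: real) \<le> indicator (\<Union>i. A i) x" for n x
    proof -
      have "incseq (\<lambda>n. \<Sum>i<n. indicator (A i) x :: real)" by (auto intro!: incseq_SucI)
      from incseq_le[OF this lim] show ?thesis .
    qed
    have "(\<lambda>n. \<integral>x. \<bar>(\<Sum>i<n. indicator (A i) x) - indicator (\<Union>i. A i) x :: real\<bar> \<partial>\<mu>) \<longlonglongrightarrow> (\<integral>x. 0 \<partial>\<mu>)"
    proof (rule integral_dominated_convergence[where w = "\<lambda>_. 1"])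
      show "AE x in \<mu>. (\<lambda>n. \<bar>(\<Sum>i<n. indicator (A i) x) - indicator (\<Union>i. A i) x :: real\<bar>) \<longlonglongrightarrow> 0"
        using lim by (intro AE_I2 tendsto_rabs_zero) (simp add: LIM_zero)
      show "AE x in \<mu>. norm \<bar>(\<Sum>i<n. indicator (A i) x) - indicator (\<Union>i. A i) x :: real\<bar> \<le> 1" for n
      proof (intro AE_I2)
        fix x
        have "0 \<le> (\<Sum>i<n. indicator (A i) x :: real)" by (intro sum_nonneg) auto
        moreover have "indicator (\<Union>i. A i) x \<le> (1::real)" by (auto simp: indicator_def)
        ultimately show "norm \<bar>(\<Sum>i<n. indicator (A i) x) - indicator (\<Union>i. A i) x :: real\<bar> \<le> 1"
          using le1[of x n] unfolding real_norm_def abs_abs by linarith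
      qed
    qed auto
    then have "eventually (\<lambda>n. (\<integral>x. \<bar>(\<Sum>i<n. indicator (A i) x) - indicator (\<Union>i. A i) x :: real\<bar> \<partial>\<mu>) < \<epsilon>/2) sequentially"
      using union(4) by (intro order_tendstoD) auto
    then obtain n where n: "(\<integral>x. \<bar>(\<Sum>i<n. indicator (A i) x) - indicator (\<Union>i. A i) x :: real\<bar> \<partial>\<mu>) < \<epsilon>/2"
      unfolding eventually_sequentially by blast
    \<comment> \<open>Half of \<open>\<epsilon>\<close> pays for cutting the union off at
      \<open>n\<close>, the other half is shared by \<open>n\<close> approximations. The
      \<open>+ 1\<close> covers the case \<open>n = 0\<close>.\<close>
    define \<eta> where "\<eta> = \<epsilon> / (2 * (real n + 1))"
    have \<eta>: "\<eta> > 0" "real n * \<eta> \<le> \<epsilon> / 2"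
      using union(4) by (auto simp: \<eta>_def field_simps)
    have "\<forall>i. \<exists>f. continuous_on UNIV f \<and> (\<forall>x. f x \<in> {0..1::real}) \<and> (\<integral>x. \<bar>f x - indicator (A i) x\<bar> \<partial>\<mu>) < \<eta>"
      using union(3) \<eta>(1) by blast
    then obtain f where f: "\<And>i. continuous_on UNIV (f i)" "\<And>i x. f i x \<in> {0..1::real}"
      "\<And>i. (\<integral>x. \<bar>f i x - indicator (A i) x\<bar> \<partial>\<mu>) < \<eta>"
      by metis
    have [measurable]: "f i \<in> borel_measurable \<mu>" for i
      by (intro meas borel_measurable_continuous_onI f)
    \<comment> \<open>Truncation at \<open>1\<close> restores values in the unit interval and moves
      no value further away from the indicator.\<close>
    let ?g = "\<lambda>x. min 1 (\<Sum>i<n. f i x)"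
    have cg: "continuous_on UNIV ?g" by (intro continuous_intros f)
    have g01: "?g x \<in> {0..1}" for x
    proof -
      have "0 \<le> (\<Sum>i<n. f i x)" by (intro sum_nonneg) (use f(2) in auto)
      then show ?thesis by auto
    qed
    have [measurable]: "?g \<in> borel_measurable \<mu>"
      by (intro meas borel_measurable_continuous_onI cg)
    have int1: "integrable \<mu> (\<lambda>x. \<bar>f i x - indicator (A i) x\<bar>)" for i
    proof (intro integrable_const_bound[of _ 1] AE_I2)
      show "norm \<bar>f i x - indicator (A i) x\<bar> \<le> 1" for x
        using f(2)[of i x] by (auto simp: indicator_def)
    qed measurable
    have int2: "integrable \<mu> (\<lambda>x. \<bar>(\<Sum>i<n. indicator (A i) x) - indicator (\<Union>i. A i) x :: real\<bar>)"
    proof (intro integrable_const_bound[of _ 1] AE_I2)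
      fix x
      have "0 \<le> (\<Sum>i<n. indicator (A i) x :: real)" by (intro sum_nonneg) auto
      moreover have "indicator (\<Union>i. A i) x \<le> (1::real)" by (auto simp: indicator_def)
      ultimately show "norm \<bar>(\<Sum>i<n. indicator (A i) x) - indicator (\<Union>i. A i) x :: real\<bar> \<le> 1"
        using le1[of x n] unfolding real_norm_def abs_abs by linarith
    qed measurable
    have "(\<integral>x. \<bar>?g x - indicator (\<Union>i. A i) x\<bar> \<partial>\<mu>) \<le>
       (\<integral>x. (\<Sum>i<n. \<bar>f i x - indicator (A i) x\<bar>) + \<bar>(\<Sum>i<n. indicator (A i) x) - indicator (\<Union>i. A i) x :: real\<bar> \<partial>\<mu>)"
    proof (rule integral_mono)
      show "integrable \<mu> (\<lambda>x. \<bar>?g x - indicator (\<Union>i. A i) x\<bar>)"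
      proof (intro integrable_const_bound[of _ 1] AE_I2)
        show "norm \<bar>?g x - indicator (\<Union>i. A i) x\<bar> \<le> 1" for x
          using g01[of x] by (auto simp: indicator_def)
      qed measurable
      fix x
      have "\<bar>?g x - indicator (\<Union>i. A i) x\<bar> \<le> \<bar>(\<Sum>i<n. f i x) - indicator (\<Union>i. A i) x\<bar>"
        using g01[of x] by (auto simp: indicator_def)
      also have "\<dots> \<le> \<bar>(\<Sum>i<n. f i x - indicator (A i) x)\<bar> + \<bar>(\<Sum>i<n. indicator (A i) x) - indicator (\<Union>i. A i) x :: real\<bar>"
        by (simp add: sum_subtractf)
      also have "\<dots> \<le> (\<Sum>i<n. \<bar>f i x - indicator (A i) x\<bar>) + \<bar>(\<Sum>i<n. indicator (A i) x) - indicator (\<Union>i. A i) x :: real\<bar>"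
        by (intro add_right_mono sum_abs)
      finally show "\<bar>?g x - indicator (\<Union>i. A i) x\<bar> \<le> \<dots>" .
    qed (use int1 int2 in auto)
    also have "\<dots> = (\<Sum>i<n. \<integral>x. \<bar>f i x - indicator (A i) x\<bar> \<partial>\<mu>) + (\<integral>x. \<bar>(\<Sum>i<n. indicator (A i) x) - indicator (\<Union>i. A i) x :: real\<bar> \<partial>\<mu>)"
      using int1 int2 by simp
    also have "\<dots> < real n * \<eta> + \<epsilon> / 2"
      using sum_mono[of "{..<n}" "\<lambda>i. \<integral>x. \<bar>f i x - indicator (A i) x\<bar> \<partial>\<mu>" "\<lambda>_. \<eta>"] f(3) n
      by (simp add: less_imp_le add_le_less_mono)
    also have "\<dots> \<le> \<epsilon>" using \<eta>(2) by simp
    finally show ?case using cg g01 by blast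
  }
qed

section \<open>Continuous functions determine and separate measures\<close>

text \<open>A measure and its image under \<open>g\<close> that agree on continuous functions agree
  on closed sets by dominated convergence, hence on all Borel sets. The sets range over the ambient
  \<open>borel\<close> and are cut down to \<open>space \<mu>\<close>, so that the induction over
  Borel sets applies directly.\<close>

lemma prob_eq_of_continuous:
  fixes X :: "'a::metric_space set"
  assumes "prob_space \<mu>" and sets: "sets \<mu> = sets (restrict_space borel X)"
    and g: "g \<in> measurable \<mu> \<mu>"
    and eq: "\<And>f. continuous_on UNIV f \<Longrightarrow> (\<integral>x. f (g x) \<partial>\<mu>) = (\<integral>x. (f x :: real) \<partial>\<mu>)"
    and B: "B \<in> sets borel"
  shows "measure \<mu> (g -` B \<inter> space \<mu>) = measure \<mu> (B \<inter> space \<mu>)"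
  using B
proof (induction rule: borel_induct_closed)
  interpret prob_space \<mu> by fact
  have sp: "space \<mu> = X"
    using sets_eq_imp_space_eq[OF sets] by (simp add: space_restrict_space)
  have mB: "A \<inter> space \<mu> \<in> sets \<mu>" if "A \<in> sets borel" for A
    using that by (auto simp: sets sp sets_restrict_space)
  have mg: "g -` A \<inter> space \<mu> \<in> sets \<mu>" if "A \<in> sets borel" for A
  proof -
    have "g -` (A \<inter> space \<mu>) \<inter> space \<mu> \<in> sets \<mu>"
      using measurable_sets[OF g mB[OF that]] .
    moreover have "g -` (A \<inter> space \<mu>) \<inter> space \<mu> = g -` A \<inter> space \<mu>"
      using measurable_space[OF g] by auto
    ultimately show ?thesis by simp
  qed
  {
    case (closed K)
    show ?case
    proof (cases "K = {}")
      case False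
      define f where "f n x = max 0 (1 - real n * infdist x K)" for n x
      have cont: "continuous_on UNIV (f n)" for n
        unfolding f_def by (intro continuous_intros)
      have f01: "f n x \<in> {0..1}" for n x
        unfolding f_def by (auto simp: infdist_nonneg)
      have lim: "(\<lambda>n. f n x) \<longlonglongrightarrow> indicator K x" for x
        unfolding f_def by (rule closed_indicator_approx[OF closed False])
      have mf: "f n \<in> borel_measurable \<mu>" for n
        using measurable_restrict_space1[OF borel_measurable_continuous_onI[OF cont]]
        unfolding measurable_cong_sets[OF sets refl] .
      \<comment> \<open>Stated for a general \<open>h\<close> because it is used twice, for the
        identity and for \<open>g\<close>.\<close>
      have *: "(\<lambda>n. \<integral>x. f n (h x) \<partial>\<mu>) \<longlonglongrightarrow> measure \<mu> (h -` K \<inter> space \<mu>)"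
        if h: "h \<in> measurable \<mu> \<mu>" and hK: "h -` K \<inter> space \<mu> \<in> sets \<mu>" for h
      proof -
        have ind: "indicator (h -` K \<inter> space \<mu>) x = (indicator K (h x) :: real)" if "x \<in> space \<mu>" for x
          using that by (auto simp: indicator_def)
        have "(\<lambda>n. \<integral>x. f n (h x) \<partial>\<mu>) \<longlonglongrightarrow> (\<integral>x. indicator (h -` K \<inter> space \<mu>) x \<partial>\<mu>)"
        proof (rule integral_dominated_convergence[where w = "\<lambda>_. 1"])
          show "AE x in \<mu>. (\<lambda>n. f n (h x)) \<longlonglongrightarrow> indicator (h -` K \<inter> space \<mu>) x"
            by (intro AE_I2) (simp add: ind lim)
          show "AE x in \<mu>. norm (f n (h x)) \<le> 1" for n
            using f01[of n] by (intro AE_I2) auto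
          show "(\<lambda>x. f n (h x)) \<in> borel_measurable \<mu>" for n
            using measurable_compose[OF h mf] .
        qed (use hK in simp_all)
        then show ?thesis using hK by (simp add: Int_absorb2 sets.sets_into_space)
      qed
      have "(\<lambda>n. \<integral>x. f n x \<partial>\<mu>) \<longlonglongrightarrow> measure \<mu> (K \<inter> space \<mu>)"
        using *[of "\<lambda>x. x"] mB[of K] closed by (simp add: vimage_def)
      moreover have "(\<lambda>n. \<integral>x. f n x \<partial>\<mu>) \<longlonglongrightarrow> measure \<mu> (g -` K \<inter> space \<mu>)"
        using *[OF g] mg[of K] closed eq[OF cont] by simp
      ultimately show ?thesis by (rule LIMSEQ_unique[symmetric])
    qed simp
  next
    case (compl A)
    have "g -` (- A) \<inter> space \<mu> = space \<mu> - (g -` A \<inter> space \<mu>)"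
      "- A \<inter> space \<mu> = space \<mu> - (A \<inter> space \<mu>)" by auto
    then show ?case using compl prob_compl mB mg by metis
  next
    case (union A)
    have "(\<lambda>i. measure \<mu> (A i \<inter> space \<mu>)) sums measure \<mu> (\<Union>i. A i \<inter> space \<mu>)"
      using union(1,2) mB
      by (intro finite_measure_UNION) (auto simp: disjoint_family_on_def)
    moreover have "(\<lambda>i. measure \<mu> (g -` A i \<inter> space \<mu>)) sums measure \<mu> (\<Union>i. g -` A i \<inter> space \<mu>)"
      using union(1,2) mg
      by (intro finite_measure_UNION) (auto simp: disjoint_family_on_def)
    ultimately show ?case
      using union(3) sums_unique2 by (fastforce simp: vimage_UN)
  }
qed

context compact_dynamics begin

text \<open>Invariance of a constructed measure can thus be tested on continuous functions, whose
  integrals are accessible as limits.\<close>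

lemma invariant_measureI:
  assumes "prob_space \<mu>" and sets: "sets \<mu> = sets (restrict_space borel X)"
    and eq: "\<And>f. continuous_on X f \<Longrightarrow> (\<integral>x. f (T x) \<partial>\<mu>) = (\<integral>x. (f x :: real) \<partial>\<mu>)"
  shows "\<mu> \<in> MX"
proof -
  interpret prob_space \<mu> by fact
  have sp: "space \<mu> = X"
    using sets_eq_imp_space_eq[OF sets] by (simp add: space_restrict_space)
  have "emeasure \<mu> (T -` A \<inter> X) = emeasure \<mu> A" if "A \<in> sets \<mu>" for A
  proof -
    have "A \<in> (\<inter>) X ` sets borel"
      using that unfolding sets sets_restrict_space .
    then obtain B where B: "B \<in> sets borel" "A = X \<inter> B" by (rule imageE)
    have "measure \<mu> (T -` B \<inter> space \<mu>) = measure \<mu> (B \<inter> space \<mu>)"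
      by (rule prob_eq_of_continuous[OF assms(1,2) measurable_T[OF sets] _ B(1)])
        (rule eq, erule continuous_on_subset, simp)
    moreover have "T -` B \<inter> space \<mu> = T -` A \<inter> X"
      using B(2) T_into sp by auto
    ultimately show ?thesis using B(2) sp by (simp add: emeasure_eq_measure Int_commute)
  qed
  then show ?thesis unfolding invariant_measures_def using assms(1,2) by simp
qed

end

section \<open>A countable uniformly dense family of unit-valued functions\<close>

primrec cone_min :: "real \<Rightarrow> (real \<times> 'a::metric_space) list \<Rightarrow> 'a \<Rightarrow> real" where
  "cone_min n [] x = 1"
| "cone_min n (p # l) x = min (fst p + n * dist x (snd p)) (cone_min n l x)"

lemma continuous_cone_min: "continuous_on UNIV (cone_min n l)"
  by (induction l) (auto intro!: continuous_intros)

lemma cone_min_le_1: "cone_min n l x \<le> 1"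
  by (induction l) auto

lemma cone_min_upper: "p \<in> set l \<Longrightarrow> cone_min n l x \<le> fst p + n * dist x (snd p)"
  by (induction l) auto

lemma cone_min_lower:
  "c \<le> 1 \<Longrightarrow> (\<And>p. p \<in> set l \<Longrightarrow> c \<le> fst p + n * dist x (snd p)) \<Longrightarrow> c \<le> cone_min n l x"
  by (induction l) auto

text \<open>Lower envelopes of finitely many steep cones over a fine net, with rational heights just
  above the values of \<open>f\<close>, stay nearly above \<open>f\<close> and are nearly attained
  at the net. Rational heights, natural slopes and the points of countably many finite nets leave
  only countably many envelopes.\<close>

lemma countable_dense_unit_functions:
  fixes X :: "'a::metric_space set"
  assumes "compact X"
  obtains D :: "('a \<Rightarrow> real) set" where "countable D"
    "\<And>g. g \<in> D \<Longrightarrow> continuous_on UNIV g" "\<And>g x. g \<in> D \<Longrightarrow> g x \<in> {0..1}"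
    "\<And>f \<epsilon>. continuous_on X f \<Longrightarrow> (\<And>x. x \<in> X \<Longrightarrow> f x \<in> {0..1}) \<Longrightarrow> \<epsilon> > 0 \<Longrightarrow>
       \<exists>g\<in>D. \<forall>x\<in>X. \<bar>g x - f x\<bar> < \<epsilon>"
proof -
  have tb: "\<exists>K. finite K \<and> K \<subseteq> X \<and> X \<subseteq> (\<Union>x\<in>K. ball x e)" if "e > 0" for e
    using seq_compact_imp_totally_bounded[OF assms[unfolded compact_eq_seq_compact_metric]] that by simp
  have "\<forall>m. \<exists>K. finite K \<and> K \<subseteq> X \<and> X \<subseteq> (\<Union>x\<in>K. ball x (1 / real (Suc m)))"
    by (intro allI tb) simp
  then obtain K where K: "\<And>m. finite (K m)" "\<And>m. K m \<subseteq> X"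
    "\<And>m. X \<subseteq> (\<Union>x\<in>K m. ball x (1 / real (Suc m)))"
    by metis
  define P where "P = (\<rat> :: real set) \<times> (\<Union>m. K m)"
  define D where "D = (\<lambda>(n, l) x. max 0 (cone_min (real n) l x)) ` (UNIV \<times> lists P)"
  show thesis
  proof (rule that)
    have "countable P" unfolding P_def
      using countable_rat countable_finite[OF K(1)] by (intro countable_SIGMA countable_UN) simp_all
    then show "countable D"
      unfolding D_def by (intro countable_image countable_SIGMA countable_lists) simp
    show "continuous_on UNIV g" if "g \<in> D" for g
    proof -
      obtain n l where "g = (\<lambda>x. max 0 (cone_min (real n) l x))"
        using \<open>g \<in> D\<close> unfolding D_def by auto
      then show ?thesis
        using continuous_cone_min[of "real n" l] by (auto intro: continuous_on_max)
    qed
    show "g x \<in> {0..1}" if "g \<in> D" for g x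
    proof -
      obtain n l where "g = (\<lambda>x. max 0 (cone_min (real n) l x))"
        using \<open>g \<in> D\<close> unfolding D_def by auto
      then show ?thesis
        using cone_min_le_1[of "real n" l x] by auto
    qed
    fix f :: "'a \<Rightarrow> real" and \<epsilon> :: real
    assume f: "continuous_on X f" and f01: "\<And>x. x \<in> X \<Longrightarrow> f x \<in> {0..1}" and "\<epsilon> > 0"
    define e where "e = \<epsilon> / 4"
    have e: "e > 0" using \<open>\<epsilon> > 0\<close> by (simp add: e_def)
    have "uniformly_continuous_on X f"
      using compact_uniformly_continuous[OF f assms] .
    then obtain \<delta> where \<delta>: "\<delta> > 0" "\<And>x y. x \<in> X \<Longrightarrow> y \<in> X \<Longrightarrow> dist x y < \<delta> \<Longrightarrow> \<bar>f x - f y\<bar> < e"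
      using e by (auto simp: uniformly_continuous_on_def dist_real_def dist_commute abs_minus_commute)
    \<comment> \<open>Beyond distance \<open>\<delta>\<close> a cone of slope \<open>n\<close> has
      risen by at least \<open>1\<close>, past all values of \<open>f\<close>; within that distance
      uniform continuity controls \<open>f\<close>. The mesh is then taken so fine that a cone rises
      by less than \<open>e\<close> across it.\<close>
    obtain n where n: "1 / \<delta> < real n" using reals_Archimedean2 by blast
    have "0 < 1 / \<delta>" using \<delta>(1) by simp
    then have n0: "real n > 0" using n by linarith
    have n\<delta>: "1 \<le> real n * \<delta>" using n \<delta>(1) by (simp add: field_simps)
    have "min \<delta> (e / real n) > 0" using \<delta>(1) e n0 by simp
    then obtain m where m: "1 / real (Suc m) < min \<delta> (e / real n)"
      by (rule nat_approx_posE)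
    have "\<forall>s. \<exists>q\<in>\<rat>. f s < q \<and> q < f s + e"
      by (intro allI Rats_dense_in_real) (use e in simp)
    then obtain q where q: "\<And>s. q s \<in> \<rat>" "\<And>s. f s < q s" "\<And>s. q s < f s + e" by metis
    obtain ss where ss: "set ss = K m" using finite_list[OF K(1)] by blast
    define l where "l = map (\<lambda>s. (q s, s)) ss"
    have "l \<in> lists P" unfolding l_def P_def using q(1) ss by auto
    then have gD: "(\<lambda>x. max 0 (cone_min (real n) l x)) \<in> D"
      unfolding D_def by (intro image_eqI[of _ _ "(n, l)"]) auto
    have "\<bar>max 0 (cone_min (real n) l x) - f x\<bar> < \<epsilon>" if x: "x \<in> X" for x
    proof -
      have "f x - e \<le> cone_min (real n) l x"
      proof (rule cone_min_lower)
        show "f x - e \<le> 1" using f01[OF x] e by auto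
        fix p assume "p \<in> set l"
        then obtain s where s: "p = (q s, s)" "s \<in> X"
          unfolding l_def using ss K(2) by auto
        show "f x - e \<le> fst p + real n * dist x (snd p)"
        proof (cases "dist x s < \<delta>")
          case True
          then have "f x - e < f s" using \<delta>(2)[OF x s(2)] by linarith
          moreover have "0 \<le> real n * dist x s" by simp
          ultimately show ?thesis using q(2)[of s] unfolding s(1) fst_conv snd_conv by linarith
        next
          case False
          then have "real n * \<delta> \<le> real n * dist x s" by (intro mult_left_mono) auto
          moreover have "f x \<le> 1" "f s \<ge> 0" using f01 x s(2) by auto
          ultimately show ?thesis using n\<delta> q(2)[of s] e unfolding s(1) fst_conv snd_conv by linarith
        qed
      qed
      moreover have "cone_min (real n) l x < f x + 3 * e"
      proof -
        obtain s where s: "s \<in> K m" "dist x s < 1 / real (Suc m)"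
          using K(3)[of m] x by (auto simp: dist_commute)
        then have sX: "s \<in> X" using K(2) by auto
        have d: "dist x s < \<delta>" "dist x s < e / real n" using s(2) m by auto
        have "real n * dist x s < e" using d(2) n0 by (simp add: field_simps)
        moreover have "f s < f x + e" using \<delta>(2)[OF x sX d(1)] by linarith
        moreover have "cone_min (real n) l x \<le> q s + real n * dist x s"
          using cone_min_upper[of "(q s, s)" l "real n" x] s(1) ss unfolding l_def by auto
        ultimately show ?thesis using q(3)[of s] by linarith
      qed
      moreover have "f x \<ge> 0" using f01[OF x] by auto
      ultimately show ?thesis using e unfolding e_def by linarith
    qed
    then show "\<exists>g\<in>D. \<forall>x\<in>X. \<bar>g x - f x\<bar> < \<epsilon>" by (intro bexI[OF _ gD]) simp
  qed
qed

section \<open>Refining periodic pseudo-orbits\<close>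

text \<open>
  Reversing mixed-radix digits makes the residues nested: the leading digits of
  \<open>\<lfloor>u N\<^sub>k\<rfloor>\<close>, for \<open>u\<close> uniform in the unit interval, become the trailing ones.
\<close>

primrec digit_reversal :: "(nat \<Rightarrow> nat) \<Rightarrow> nat \<Rightarrow> nat \<Rightarrow> nat" where
  "digit_reversal N 0 q = q"
| "digit_reversal N (Suc k) q =
     digit_reversal N k (q div (N (Suc k) div N k)) + N k * (q mod (N (Suc k) div N k))"

lemma digit_reversal_less:
  assumes "\<And>k. N k > 0" "\<And>k. N k dvd N (Suc k)" "q < N k"
  shows "digit_reversal N k q < N k"
  using assms(3)
proof (induction k arbitrary: q)
  case (Suc k)
  define m where "m = N (Suc k) div N k"
  have m: "N (Suc k) = N k * m" "m > 0"
    using assms(1)[of "Suc k"] assms(2)[of k] by (auto simp: m_def)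
  have "digit_reversal N k (q div m) < N k"
    using Suc m by (intro Suc.IH) (simp add: less_mult_imp_div_less)
  moreover have "q mod m < m" using m(2) by simp
  then have "N k * (q mod m + 1) \<le> N k * m" by (intro mult_le_mono2) simp
  ultimately show ?case by (simp add: m(1) flip: m_def)
qed simp

text \<open>The last digit of \<open>q\<close> is the leading digit of \<open>i\<close>, and
  induction determines the remaining ones. Naming the single preimage \<open>p\<close> makes the
  event \<open>r k u = i\<close> in \<open>random_residues\<close> one interval of length
  \<open>1 / N k\<close>.\<close>

lemma digit_reversal_inverse:
  assumes "\<And>k. N k > 0" "\<And>k. N k dvd N (Suc k)" "i < N k"
  shows "\<exists>p<N k. \<forall>q<N k. digit_reversal N k q = i \<longleftrightarrow> q = p"
  using assms(3)
proof (induction k arbitrary: i)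
  case (Suc k)
  define m where "m = N (Suc k) div N k"
  have m: "N (Suc k) = N k * m" "m > 0"
    using assms(1)[of "Suc k"] assms(2)[of k] by (auto simp: m_def)
  have "i mod N k < N k" using assms(1) by simp
  from Suc.IH[OF this] obtain p where p: "p < N k"
    "\<And>q. q < N k \<Longrightarrow> digit_reversal N k q = i mod N k \<longleftrightarrow> q = p" by blast
  have d: "i div N k < m" using Suc.prems m by (simp add: less_mult_imp_div_less mult.commute)
  show ?case
  proof (intro exI[of _ "p * m + i div N k"] conjI allI impI)
    have "(p + 1) * m \<le> N k * m" using p(1) by (intro mult_le_mono1) simp
    then show "p * m + i div N k < N (Suc k)" using d m by simp
    fix q assume "q < N (Suc k)"
    then have q: "q div m < N k" using m by (simp add: less_mult_imp_div_less)
    have lt: "digit_reversal N k (q div m) < N k"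
      using digit_reversal_less[of N, OF assms(1,2) q] .
    have "digit_reversal N (Suc k) q = i \<longleftrightarrow>
        digit_reversal N k (q div m) = i mod N k \<and> q mod m = i div N k"
    proof
      assume *: "digit_reversal N (Suc k) q = i"
      have "i = digit_reversal N k (q div m) + N k * (q mod m)"
        using * by (simp add: m_def)
      then show "digit_reversal N k (q div m) = i mod N k \<and> q mod m = i div N k"
        using lt by simp
    qed (simp flip: m_def)
    also have "\<dots> \<longleftrightarrow> q div m = p \<and> q mod m = i div N k"
      using p(2)[OF q] by simp
    also have "\<dots> \<longleftrightarrow> q = p * m + i div N k"
    proof
      assume "q div m = p \<and> q mod m = i div N k"
      then show "q = p * m + i div N k" using div_mult_mod_eq[of q m] by simp
    qed (use d in simp)
    finally show "digit_reversal N (Suc k) q = i \<longleftrightarrow> q = p * m + i div N k" .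
  qed
qed auto

text \<open>The functions \<open>r k\<close> describe a Haar-random element of the odometer \<open>lim \<int>/N\<^sub>k\<close>.\<close>

lemma random_residues:
  fixes N :: "nat \<Rightarrow> nat"
  assumes pos: "\<And>k. N k > 0" and dvd: "\<And>k. N k dvd N (Suc k)"
  obtains M :: "real measure" and r :: "nat \<Rightarrow> real \<Rightarrow> nat" where
    "prob_space M" "\<And>k. r k \<in> measurable M (count_space UNIV)"
    "\<And>k u. r k u < N k" "\<And>k u. r (Suc k) u mod N k = r k u"
    "\<And>k i. i < N k \<Longrightarrow> measure M (r k -` {i} \<inter> space M) = 1 / real (N k)"
proof
  define M where "M = uniform_measure lborel {0..<1::real}"
  \<comment> \<open>\<open>frac\<close> makes \<open>c k u < N k\<close> hold for every real
    \<open>u\<close>, without an exceptional set; on the half-open unit interval it is the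
    identity.\<close>
  define c where "c k u = nat \<lfloor>frac u * real (N k)\<rfloor>" for k and u :: real
  define r where "r k u = digit_reversal N k (c k u)" for k u
  show "prob_space M" unfolding M_def
    by (rule prob_space_uniform_measure) simp_all
  have "c k \<in> measurable borel (count_space UNIV)" for k
    unfolding c_def frac_def by measurable
  then have c_meas: "c k \<in> measurable M (count_space UNIV)" for k
    unfolding M_def by (simp add: measurable_def)
  show "r k \<in> measurable M (count_space UNIV)" for k
    unfolding r_def by (rule measurable_compose[OF c_meas]) simp
  have c_less: "c k u < N k" for k u
  proof -
    have "frac u * real (N k) < 1 * real (N k)"
      using pos[of k] by (intro mult_strict_right_mono frac_lt_1) auto
    then have "\<lfloor>frac u * real (N k)\<rfloor> < int (N k)" by (simp add: floor_less_iff)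
    then show ?thesis using pos[of k] unfolding c_def by simp
  qed
  show "r k u < N k" for k u
    unfolding r_def using digit_reversal_less[of N, OF pos dvd c_less] .
  show "r (Suc k) u mod N k = r k u" for k u
  proof -
    define m where "m = N (Suc k) div N k"
    have m: "N (Suc k) = N k * m" "m > 0"
      using pos[of "Suc k"] dvd[of k] by (auto simp: m_def)
    \<comment> \<open>Dropping the last digit of \<open>c (Suc k) u\<close> yields
      \<open>c k u\<close>. After the reversal this digit is the most significant one, so reduction
      modulo \<open>N k\<close> removes it.\<close>
    have "frac u * real (N k) = (frac u * real (N (Suc k))) / real_of_int (int m)"
      using m by simp
    then have "\<lfloor>frac u * real (N k)\<rfloor> = \<lfloor>frac u * real (N (Suc k))\<rfloor> div int m"
      using floor_divide_real_eq_div[of "int m" "frac u * real (N (Suc k))"] by simp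
    then have "c (Suc k) u div m = c k u"
      unfolding c_def by (simp add: nat_div_distrib)
    then have "r (Suc k) u = r k u + N k * (c (Suc k) u mod m)"
      by (simp add: r_def m_def)
    then show ?thesis
      using digit_reversal_less[of N, OF pos dvd c_less] by (simp add: r_def)
  qed
  show "measure M (r k -` {i} \<inter> space M) = 1 / real (N k)" if i: "i < N k" for k i
  proof -
    obtain p where p: "p < N k" "\<And>q. q < N k \<Longrightarrow> digit_reversal N k q = i \<longleftrightarrow> q = p"
      using digit_reversal_inverse[of N, OF pos dvd i] by blast
    have Npos: "real (N k) > 0" using pos by simp
    have iff: "r k u = i \<longleftrightarrow> u \<in> {real p / real (N k) ..< (real p + 1) / real (N k)}"
      if "u \<in> {0..<1}" for u
    proof -
      have "frac u = u" using that by (simp add: frac_eq)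
      then have "r k u = i \<longleftrightarrow> nat \<lfloor>u * real (N k)\<rfloor> = p"
        using p(2)[OF c_less[of k u]] by (simp add: r_def c_def)
      also have "\<dots> \<longleftrightarrow> \<lfloor>u * real (N k)\<rfloor> = int p"
        using that by auto
      also have "\<dots> \<longleftrightarrow> real p \<le> u * real (N k) \<and> u * real (N k) < real p + 1"
        by (simp add: floor_eq_iff)
      finally show ?thesis using Npos by (simp add: field_simps)
    qed
    have "real p + 1 \<le> real (N k)" using p(1) by simp
    then have sub: "{real p / real (N k) ..< (real p + 1) / real (N k)} \<subseteq> {0..<1}"
      using Npos by (auto simp: field_simps)
    have "{0..<1} \<inter> r k -` {i} = {real p / real (N k) ..< (real p + 1) / real (N k)}"
      using iff sub by blast
    moreover have "r k -` {i} \<in> sets lborel"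
      using measurable_sets[OF \<open>\<And>k. r k \<in> measurable M (count_space UNIV)\<close>[of k], of "{i}"]
      by (simp add: M_def)
    ultimately have "measure M (r k -` {i}) = measure lborel {real p / real (N k) ..< (real p + 1) / real (N k)}"
      unfolding M_def by (subst measure_uniform_measure) simp_all
    also have "\<dots> = 1 / real (N k)"
      using Npos by (simp add: divide_right_mono field_simps)
    finally show ?thesis by (simp add: M_def)
  qed
qed

section \<open>Limits of ever finer cycles\<close>

lemma geometric_convergence:
  fixes X :: "'a::metric_space set"
  assumes "compact X" "\<And>k. w k \<in> X" "\<And>k. dist (w (Suc k)) (w k) < \<epsilon> / 2 ^ (k + 2)"
  obtains l where "l \<in> X" "w \<longlonglongrightarrow> l" "dist l (w 0) \<le> \<epsilon>"
proof -
  have "0 \<le> dist (w (Suc 0)) (w 0)" by simp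
  also have "\<dots> < \<epsilon> / 2 ^ (0 + 2)" by (rule assms(3))
  finally have \<epsilon>: "\<epsilon> > 0" by simp
  \<comment> \<open>The bound is kept as a difference of two geometric terms, since this telescopes
    in the induction.\<close>
  have *: "dist (w (k + n)) (w k) \<le> \<epsilon> / 2 ^ (k + 1) - \<epsilon> / 2 ^ (k + n + 1)" for k n
  proof (induction n)
    case (Suc n)
    have "dist (w (k + Suc n)) (w k) \<le> dist (w (Suc (k + n))) (w (k + n)) + dist (w (k + n)) (w k)"
      using dist_triangle by simp
    also have "\<dots> \<le> \<epsilon> / 2 ^ (k + n + 2) + (\<epsilon> / 2 ^ (k + 1) - \<epsilon> / 2 ^ (k + n + 1))"
      using Suc assms(3)[of "k + n"] by simp
    also have "\<dots> = \<epsilon> / 2 ^ (k + 1) - \<epsilon> / 2 ^ (k + Suc n + 1)"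
      by (simp add: field_simps power_add)
    finally show ?case .
  qed simp
  have le: "dist (w (k + n)) (w k) \<le> \<epsilon> / 2 ^ k" for k n
  proof -
    have "\<epsilon> / 2 ^ (k + 1) - \<epsilon> / 2 ^ (k + n + 1) \<le> \<epsilon> / 2 ^ (k + 1)" using \<epsilon> by simp
    also have "\<dots> \<le> \<epsilon> / 2 ^ k" using \<epsilon> by (simp add: field_simps)
    finally show ?thesis using *[of k n] by linarith
  qed
  have "Cauchy w"
    unfolding Cauchy_altdef
  proof (intro allI impI)
    fix e :: real assume e: "e > 0"
    have "(\<lambda>k. \<epsilon> * (1 / 2) ^ k) \<longlonglongrightarrow> \<epsilon> * 0"
      by (intro tendsto_mult tendsto_const LIMSEQ_power_zero) simp
    then have "eventually (\<lambda>k. \<epsilon> * (1 / 2) ^ k < e / 2) sequentially"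
      using e by (intro order_tendstoD) auto
    then obtain k where k: "\<epsilon> * (1 / 2) ^ k < e / 2"
      unfolding eventually_sequentially by blast
    have kle: "\<epsilon> / 2 ^ k < e / 2" using k by (simp add: power_one_over field_simps)
    show "\<exists>k. \<forall>m\<ge>k. \<forall>n>m. dist (w m) (w n) < e"
    proof (intro exI[of _ k] allI impI)
      fix m n assume "k \<le> m" "m < n"
      then have "dist (w m) (w k) \<le> \<epsilon> / 2 ^ k" "dist (w n) (w k) \<le> \<epsilon> / 2 ^ k"
        using le[of k "m - k"] le[of k "n - k"] by simp_all
      then show "dist (w m) (w n) < e"
        using dist_triangle2[of "w m" "w n" "w k"] kle by linarith
    qed
  qed
  then obtain l where l: "l \<in> X" "w \<longlonglongrightarrow> l"
    using assms(2) completeE[OF compact_imp_complete[OF assms(1)], of w] by metis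
  have "(\<lambda>n. dist (w n) (w 0)) \<longlonglongrightarrow> dist l (w 0)"
    by (intro tendsto_intros l)
  then have "dist l (w 0) \<le> \<epsilon>"
    by (rule LIMSEQ_le_const2) (use le[of 0] in auto)
  with l that show thesis by blast
qed

lemma periodic_cong:
  fixes z :: "nat \<Rightarrow> 'a"
  assumes "\<And>n. z (n + N) = z n" "m mod N = n mod N"
  shows "z m = z n"
proof -
  have *: "z (n + j * N) = z n" for n j
  proof (induction j)
    case (Suc j)
    have "z (n + Suc j * N) = z ((n + j * N) + N)" by (simp add: algebra_simps)
    then show ?case using Suc assms(1) by simp
  qed simp
  have "z m = z (m mod N)" for m
    using *[of "m mod N" "m div N"] by simp
  then show ?thesis using assms(2) by metis
qed

context compact_dynamics begin

text \<open>Both return times are multiples of \<open>N\<close>, so the segment between them starts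
  at phase \<open>0\<close> of \<open>z\<close> and its length is a multiple of \<open>N\<close>;
  closeness to \<open>z\<close> therefore survives index by index under periodic repetition.\<close>

lemma cycle_refinement:
  assumes shadow: "\<And>x. pseudo_orbit X T \<delta> x \<Longrightarrow> \<exists>y\<in>X. traces T \<epsilon> y x"
    and z: "pseudo_orbit X T \<delta> z" "\<And>n. z (n + N) = z n" "N > 0" and "\<delta>' > 0"
  shows "\<exists>N' z'. N' > 0 \<and> N dvd N' \<and> (\<forall>n. z' (n + N') = z' n) \<and> pseudo_orbit X T \<delta>' z' \<and>
    (\<forall>n. dist (z' n) (z n) < \<epsilon>)"
proof -
  obtain y where y: "y \<in> X" "\<And>n. dist ((T ^^ n) y) (z n) < \<epsilon>"
    using shadow[OF z(1)] unfolding traces_def by blast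
  have "\<forall>i. (T ^^ (i * N)) y \<in> X" using funpow_into[OF y(1)] by blast
  then obtain l s where s: "strict_mono s" "((\<lambda>i. (T ^^ (i * N)) y) \<circ> s) \<longlonglongrightarrow> l"
    using compact_space unfolding compact_eq_seq_compact_metric seq_compact_def by metis
  have "Cauchy ((\<lambda>i. (T ^^ (i * N)) y) \<circ> s)" using s(2) LIMSEQ_imp_Cauchy by blast
  then obtain k where "\<forall>m\<ge>k. \<forall>n\<ge>k. dist ((T ^^ (s m * N)) y) ((T ^^ (s n * N)) y) < \<delta>'"
    using \<open>\<delta>' > 0\<close> unfolding Cauchy_def comp_def by blast
  then have "dist ((T ^^ (s (Suc k) * N)) y) ((T ^^ (s k * N)) y) < \<delta>'" by simp
  moreover have "s k < s (Suc k)" using s(1) by (simp add: strict_mono_Suc_iff)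
  ultimately obtain i j where ij: "i < j" "dist ((T ^^ (j * N)) y) ((T ^^ (i * N)) y) < \<delta>'" by blast
  define N' where "N' = (j - i) * N"
  have N': "N' > 0" "N dvd N'" "i * N + N' = j * N"
    using ij(1) z(3) by (auto simp: N'_def simp flip: add_mult_distrib)
  define z' where "z' n = (T ^^ (i * N + n mod N')) y" for n
  \<comment> \<open>All steps are exact orbit steps except the one with
    \<open>Suc (n mod N') = N'\<close>, where the repetition jumps from the iterate
    \<open>j * N\<close> back to the iterate \<open>i * N\<close>.\<close>
  have "dist (T (z' n)) (z' (Suc n)) < \<delta>'" for n
  proof (cases "Suc (n mod N') = N'")
    case True
    have "T (z' n) = (T ^^ (i * N + Suc (n mod N'))) y" by (simp add: z'_def)
    also have "\<dots> = (T ^^ (j * N)) y" by (simp only: True N'(3))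
    finally show ?thesis using True ij(2) by (simp add: z'_def mod_Suc)
  qed (use \<open>\<delta>' > 0\<close> in \<open>simp add: z'_def mod_Suc\<close>)
  moreover have "z' n \<in> X" for n unfolding z'_def by (rule funpow_into[OF y(1)])
  ultimately have "pseudo_orbit X T \<delta>' z'" unfolding pseudo_orbit_def by blast
  moreover have "dist (z' n) (z n) < \<epsilon>" for n
  proof -
    have "(i * N + n mod N') mod N = n mod N" using N'(2) by (simp add: mod_mod_cancel)
    then have "z (i * N + n mod N') = z n" using periodic_cong[of z N, OF z(2)] by blast
    then show ?thesis using y(2)[of "i * N + n mod N'"] by (simp add: z'_def)
  qed
  moreover have "z' (n + N') = z' n" for n by (simp add: z'_def)
  ultimately show ?thesis using N' by blast
qed

end

section \<open>The measure carried by a limit of cycles\<close>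

lemma integral_of_uniform:
  fixes g :: "nat \<Rightarrow> real"
  assumes "prob_space M" "r \<in> measurable M (count_space UNIV)" "\<And>u. r u < N"
    and "\<And>i. i < N \<Longrightarrow> measure M (r -` {i} \<inter> space M) = 1 / real N"
  shows "(\<integral>u. g (r u) \<partial>M) = (\<Sum>i<N. g i) / real N"
proof -
  interpret prob_space M by fact
  have meas: "r -` {i} \<inter> space M \<in> sets M" for i
    using measurable_sets[OF assms(2)] by simp
  have "(\<integral>u. g (r u) \<partial>M) = (\<integral>u. (\<Sum>i<N. g i * indicator (r -` {i} \<inter> space M) u) \<partial>M)"
  proof (rule Bochner_Integration.integral_cong[OF refl])
    fix u assume "u \<in> space M"
    then have "(\<Sum>i<N. g i * indicator (r -` {i} \<inter> space M) u) = (\<Sum>i<N. if i = r u then g i else 0)"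
      by (intro sum.cong) (auto simp: indicator_def)
    then show "g (r u) = (\<Sum>i<N. g i * indicator (r -` {i} \<inter> space M) u)"
      using assms(3) by simp
  qed
  also have "\<dots> = (\<Sum>i<N. g i * measure M (r -` {i} \<inter> space M))"
    using meas by (subst Bochner_Integration.integral_sum)
      (auto intro!: integrable_mult_right integrable_real_indicator simp: emeasure_eq_measure)
  also have "\<dots> = (\<Sum>i<N. g i / real N)"
    by (intro sum.cong) (auto simp: assms(4))
  finally show ?thesis by (simp add: sum_divide_distrib)
qed

context compact_dynamics begin

text \<open>The tolerances \<open>\<epsilon> / 2 ^ (k + 2)\<close> have a sum below
  \<open>\<epsilon>\<close>, so every limit stays within \<open>\<epsilon>\<close> of the very first
  cycle, however far the refinement goes. The shift \<open>s\<close> depends on the point: it is the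
  residue \<open>r 0 u\<close>.\<close>

lemma measure_traced_by_cycle:
  assumes shadowing: "shadowing_property X T" and \<epsilon>: "\<epsilon> > 0"
  shows "\<exists>\<delta>>0. \<forall>N z. N > 0 \<and> (\<forall>n. z (n + N) = z n) \<and> pseudo_orbit X T \<delta> z \<longrightarrow>
       (\<exists>\<nu>\<in>MX. AE x in \<nu>. \<exists>s. \<forall>i. dist ((T ^^ i) x) (z (s + i)) \<le> \<epsilon>)"
proof -
  \<comment> \<open>Asking for \<open>\<delta> \<le> e\<close> makes the jumps of the
    \<open>k\<close>-th cycle tend to \<open>0\<close> together with \<open>e k\<close>, so that the
    limits \<open>Y i u\<close> form genuine orbits.\<close>
  have "\<exists>\<delta>>0. \<delta> \<le> e \<and> (\<forall>x. pseudo_orbit X T \<delta> x \<longrightarrow> (\<exists>y\<in>X. traces T e y x))"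
    if e: "e > 0" for e :: real
  proof -
    obtain \<delta> where "\<delta> > 0" "\<And>x. pseudo_orbit X T \<delta> x \<Longrightarrow> \<exists>y\<in>X. traces T e y x"
      using shadowing e unfolding shadowing_property_def by blast
    moreover have "pseudo_orbit X T \<delta> x" if "pseudo_orbit X T (min \<delta> e) x" for x
      using that unfolding pseudo_orbit_def by simp
    ultimately show ?thesis using e by (intro exI[of _ "min \<delta> e"]) simp
  qed
  then obtain d where d: "\<And>e. e > 0 \<Longrightarrow> d e > 0" "\<And>e. e > 0 \<Longrightarrow> d e \<le> e"
    "\<And>e x. e > 0 \<Longrightarrow> pseudo_orbit X T (d e) x \<Longrightarrow> \<exists>y\<in>X. traces T e y x"
    by metis
  define e where "e k = \<epsilon> / 2 ^ (k + 2)" for k :: nat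
  have e: "e k > 0" for k using \<epsilon> by (simp add: e_def)
  have e_lim: "e \<longlonglongrightarrow> 0"
  proof -
    have "(\<lambda>k. \<epsilon> / 4 * (1 / 2) ^ k) \<longlonglongrightarrow> \<epsilon> / 4 * 0"
      by (intro tendsto_mult tendsto_const LIMSEQ_power_zero) simp
    moreover have "e = (\<lambda>k. \<epsilon> / 4 * (1 / 2) ^ k)"
      unfolding e_def by (auto simp: power_one_over field_simps)
    ultimately show ?thesis by simp
  qed
  have "\<exists>\<nu>\<in>MX. AE x in \<nu>. \<exists>s. \<forall>i. dist ((T ^^ i) x) (z0 (s + i)) \<le> \<epsilon>"
    if N0: "N0 > 0" and z0: "\<And>n. z0 (n + N0) = z0 n" "pseudo_orbit X T (d (e 0)) z0"
    for N0 :: nat and z0 :: "nat \<Rightarrow> 'a"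
  proof -
    \<comment> \<open>The clause for \<open>k = 0\<close> pins the given cycle as the start of the
      sequence obtained by dependent choice.\<close>
    define P where "P k p \<longleftrightarrow> (case p of (N, z) \<Rightarrow> N > 0 \<and> (\<forall>n. z (n + N) = z n) \<and>
      pseudo_orbit X T (d (e k)) z \<and> (k = 0 \<longrightarrow> N = N0 \<and> z = z0))" for k :: nat and p :: "nat \<times> (nat \<Rightarrow> 'a)"
    define Q where "Q k p p' \<longleftrightarrow> (case p of (N, z) \<Rightarrow> case p' of (N', z') \<Rightarrow>
      N dvd N' \<and> (\<forall>n. dist (z' n) (z n) < e k))" for k and p p' :: "nat \<times> (nat \<Rightarrow> 'a)"
    have "\<exists>f. \<forall>k. P k (f k) \<and> Q k (f k) (f (Suc k))"
    proof (rule dependent_nat_choice)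
      show "\<exists>x. P 0 x" using N0 z0 by (intro exI[of _ "(N0, z0)"]) (simp add: P_def)
      fix p k assume P: "P k p"
      obtain N z where p: "p = (N, z)" by fastforce
      have "\<exists>N' z'. N' > 0 \<and> N dvd N' \<and> (\<forall>n. z' (n + N') = z' n) \<and>
          pseudo_orbit X T (d (e (Suc k))) z' \<and> (\<forall>n. dist (z' n) (z n) < e k)"
        by (rule cycle_refinement[where \<delta> = "d (e k)"])
          (use P p d e in \<open>auto simp: P_def\<close>)
      then obtain N' z' where "N' > 0" "N dvd N'" "\<forall>n. z' (n + N') = z' n"
        "pseudo_orbit X T (d (e (Suc k))) z'" "\<forall>n. dist (z' n) (z n) < e k" by blast
      then show "\<exists>p'. P (Suc k) p' \<and> Q k p p'"
        by (intro exI[of _ "(N', z')"]) (simp add: P_def Q_def p)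
    qed
    then obtain f where f: "\<And>k. P k (f k)" "\<And>k. Q k (f k) (f (Suc k))" by blast
    define N where "N k = fst (f k)" for k
    define z where "z k = snd (f k)" for k
    have N: "N k > 0" "N k dvd N (Suc k)" for k
      using f(1)[of k] f(2)[of k] unfolding P_def Q_def N_def by (auto simp: split_beta)
    have period: "z k (n + N k) = z k n" for k n
      using f(1)[of k] unfolding P_def N_def z_def by (auto simp: split_beta)
    have orbit: "z k n \<in> X" "dist (T (z k n)) (z k (Suc n)) < d (e k)" for k n
      using f(1)[of k] unfolding P_def z_def pseudo_orbit_def by (auto simp: split_beta)
    have close: "dist (z (Suc k) n) (z k n) < e k" for k n
      using f(2)[of k] unfolding Q_def z_def by (auto simp: split_beta)
    have start: "N 0 = N0" "z 0 = z0"
      using f(1)[of 0] unfolding P_def N_def z_def by (auto simp: split_beta)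
    obtain M :: "real measure" and r where M: "prob_space M"
      and r: "\<And>k. r k \<in> measurable M (count_space UNIV)" "\<And>k u. r k u < N k"
        "\<And>k u. r (Suc k) u mod N k = r k u"
        "\<And>k i. i < N k \<Longrightarrow> measure M (r k -` {i} \<inter> space M) = 1 / real (N k)"
      using random_residues[of N, OF N] by blast
    interpret prob_space M by fact
    have ex: "\<exists>l. l \<in> X \<and> (\<lambda>k. z k (r k u + i)) \<longlonglongrightarrow> l \<and> dist l (z0 (r 0 u + i)) \<le> \<epsilon>" for u i
    proof -
      have "dist (z (Suc k) (r (Suc k) u + i)) (z k (r k u + i)) < \<epsilon> / 2 ^ (k + 2)" for k
      proof -
        \<comment> \<open>Coherent residues put both indices at the same phase of the
          \<open>k\<close>-th cycle, so consecutive terms compare this cycle with its refinement at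
          a single index.\<close>
        have "(r (Suc k) u + i) mod N k = (r k u + i) mod N k"
          by (simp add: mod_add_left_eq flip: r(3)[of k u])
        then have "z k (r (Suc k) u + i) = z k (r k u + i)"
          by (rule periodic_cong[of "z k" "N k", OF period])
        then show ?thesis using close[of k "r (Suc k) u + i"] unfolding e_def by simp
      qed
      from geometric_convergence[OF compact_space, of "\<lambda>k. z k (r k u + i)", OF orbit(1) this]
      obtain l where "l \<in> X" "(\<lambda>k. z k (r k u + i)) \<longlonglongrightarrow> l" "dist l (z 0 (r 0 u + i)) \<le> \<epsilon>" .
      then show ?thesis unfolding start by blast
    qed
    define Y where "Y i u = (SOME l. l \<in> X \<and> (\<lambda>k. z k (r k u + i)) \<longlonglongrightarrow> l \<and> dist l (z0 (r 0 u + i)) \<le> \<epsilon>)" for i u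
    have Y: "Y i u \<in> X" "(\<lambda>k. z k (r k u + i)) \<longlonglongrightarrow> Y i u" "dist (Y i u) (z0 (r 0 u + i)) \<le> \<epsilon>" for i u
      using someI_ex[OF ex[of u i]] by (simp_all add: Y_def)
    have TY: "T (Y i u) = Y (Suc i) u" for i u
    proof -
      have "(\<lambda>k. T (z k (r k u + i))) \<longlonglongrightarrow> T (Y i u)"
        using orbit(1) by (intro continuous_on_tendsto_compose[OF continuous_T Y(2) Y(1)]) simp
      moreover have "(\<lambda>k. z k (r k u + Suc i)) \<longlonglongrightarrow> Y (Suc i) u" by (rule Y(2))
      then have "(\<lambda>k. z k (Suc (r k u + i))) \<longlonglongrightarrow> Y (Suc i) u" by simp
      ultimately have "(\<lambda>k. dist (T (z k (r k u + i))) (z k (Suc (r k u + i)))) \<longlonglongrightarrow> dist (T (Y i u)) (Y (Suc i) u)"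
        by (rule tendsto_dist)
      moreover have "(\<lambda>k. dist (T (z k (r k u + i))) (z k (Suc (r k u + i)))) \<longlonglongrightarrow> 0"
      proof (rule real_tendsto_sandwich[OF _ _ tendsto_const e_lim])
        show "eventually (\<lambda>k. dist (T (z k (r k u + i))) (z k (Suc (r k u + i))) \<le> e k) sequentially"
          by (intro always_eventually allI less_imp_le less_le_trans[OF orbit(2) d(2)[OF e]])
      qed simp
      ultimately have "dist (T (Y i u)) (Y (Suc i) u) = 0" by (rule LIMSEQ_unique)
      then show ?thesis by simp
    qed
    have orbit_Y: "(T ^^ i) (Y 0 u) = Y i u" for i u
      by (induction i) (simp_all add: TY)
    define R where "R = (restrict_space borel X :: 'a measure)"
    have spR: "space R = X" by (simp add: R_def space_restrict_space)
    have Y_meas: "Y i \<in> measurable M R" for i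
      unfolding R_def
    proof (rule measurable_restrict_space2)
      show "Y i \<in> borel_measurable M"
      proof (rule borel_measurable_LIMSEQ_metric)
        show "(\<lambda>u. z k (r k u + i)) \<in> borel_measurable M" for k
          by (rule measurable_compose[OF r(1)]) simp
      qed (rule Y(2))
    qed (use Y(1) in auto)
    \<comment> \<open>Since \<open>r k\<close> is uniform, integrals along \<open>Y i\<close> are
      limits of averages over the cycles. A full period gives the same average for
      \<open>i = 1\<close> as for \<open>i = 0\<close>, which is the invariance of
      \<open>\<nu>\<close>.\<close>
    have avg: "(\<lambda>k. (\<Sum>n<N k. g (z k (n + i))) / real (N k)) \<longlonglongrightarrow> (\<integral>u. g (Y i u) \<partial>M)"
      if g: "continuous_on X g" for g :: "'a \<Rightarrow> real" and i
    proof -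
      obtain B where B: "\<And>x. x \<in> X \<Longrightarrow> \<bar>g x\<bar> \<le> B" using bounded_continuous[OF g] by blast
      have "(\<lambda>k. \<integral>u. g (z k (r k u + i)) \<partial>M) \<longlonglongrightarrow> (\<integral>u. g (Y i u) \<partial>M)"
      proof (rule integral_dominated_convergence[where w = "\<lambda>_. B"])
        show "(\<lambda>u. g (Y i u)) \<in> borel_measurable M"
          by (rule measurable_compose[OF Y_meas measurable_continuous[OF _ g]]) (simp add: R_def)
        show "(\<lambda>u. g (z k (r k u + i))) \<in> borel_measurable M" for k
          by (rule measurable_compose[OF r(1)]) simp
        show "AE u in M. (\<lambda>k. g (z k (r k u + i))) \<longlonglongrightarrow> g (Y i u)"
          using orbit(1) by (intro AE_I2 continuous_on_tendsto_compose[OF g Y(2) Y(1)]) simp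
        show "AE u in M. norm (g (z k (r k u + i))) \<le> B" for k
          using B orbit(1) by simp
      qed simp
      moreover have "(\<integral>u. g (z k (r k u + i)) \<partial>M) = (\<Sum>n<N k. g (z k (n + i))) / real (N k)" for k
        by (rule integral_of_uniform[OF M r(1,2,4)])
      ultimately show ?thesis by simp
    qed
    define \<nu> where "\<nu> = distr M R (Y 0)"
    have sets_\<nu>: "sets \<nu> = sets (restrict_space borel X)" by (simp add: \<nu>_def R_def)
    have "\<nu> \<in> MX"
    proof (rule invariant_measureI[OF _ sets_\<nu>])
      show "prob_space \<nu>" unfolding \<nu>_def by (rule prob_space_distr[OF Y_meas])
      fix g :: "'a \<Rightarrow> real" assume g: "continuous_on X g"
      have gm: "g \<in> borel_measurable R"
        by (rule measurable_continuous[OF _ g]) (simp add: R_def)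
      have gTm: "(\<lambda>x. g (T x)) \<in> borel_measurable R"
        by (rule measurable_compose[OF measurable_T gm]) (simp add: R_def)
      have "(\<Sum>n<N k. g (z k (n + 1))) = (\<Sum>n<N k. g (z k (n + 0)))" for k
      proof -
        have "(\<Sum>n<Suc (N k). g (z k n)) = g (z k 0) + (\<Sum>n<N k. g (z k (Suc n)))"
          by (rule sum.lessThan_Suc_shift)
        then show ?thesis using period[of k 0] by simp
      qed
      then have "(\<integral>u. g (Y 1 u) \<partial>M) = (\<integral>u. g (Y 0 u) \<partial>M)"
        using avg[OF g, of 0] avg[OF g, of 1] by (intro LIMSEQ_unique) simp_all
      then show "(\<integral>x. g (T x) \<partial>\<nu>) = (\<integral>x. g x \<partial>\<nu>)"
        unfolding \<nu>_def by (simp add: integral_distr[OF Y_meas] gm gTm TY)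
    qed
    moreover have "AE x in \<nu>. \<exists>s. \<forall>i. dist ((T ^^ i) x) (z0 (s + i)) \<le> \<epsilon>"
    proof -
      have [measurable]: "(\<lambda>x. dist ((T ^^ i) x) c) \<in> borel_measurable R" for i c
      proof (rule measurable_continuous)
        show "continuous_on X (\<lambda>x. dist ((T ^^ i) x) c)"
          by (intro continuous_intros continuous_funpow)
      qed (simp add: R_def)
      \<comment> \<open>A countable union over \<open>s\<close> of countable intersections over
        \<open>i\<close>. Its measurability lets the statement be pulled back to \<open>M\<close>,
        where the shift \<open>r 0 u\<close> works for every \<open>u\<close>.\<close>
      have "{x \<in> space R. \<exists>s. \<forall>i. dist ((T ^^ i) x) (z0 (s + i)) \<le> \<epsilon>} \<in> sets R"
        by measurable
      then show ?thesis
        unfolding \<nu>_def using Y(3) orbit_Y by (subst AE_distr_iff[OF Y_meas]) auto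
    qed
    ultimately show ?thesis by blast
  qed
  then have "\<forall>N z. N > 0 \<and> (\<forall>n. z (n + N) = z n) \<and> pseudo_orbit X T (d (e 0)) z \<longrightarrow>
      (\<exists>\<nu>\<in>MX. AE x in \<nu>. \<exists>s. \<forall>i. dist ((T ^^ i) x) (z (s + i)) \<le> \<epsilon>)"
    by (intro allI impI) (elim conjE, simp only:)
  then show ?thesis using d(1)[OF e] by (intro exI[of _ "d (e 0)"] conjI)
qed

end

section \<open>Sampling a measure by finitely many points\<close>

lemma successively_nth:
  "successively P xs \<Longrightarrow> Suc i < length xs \<Longrightarrow> P (xs ! i) (xs ! Suc i)"
proof (induction xs arbitrary: i)
  case (Cons x xs)
  then show ?case by (cases i) (auto simp: successively_Cons hd_conv_nth)
qed simp

lemma finite_family_modulus: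
  fixes X :: "'a::metric_space set" and F :: "('a \<Rightarrow> real) set"
  assumes "finite F" "compact X" "\<And>f. f \<in> F \<Longrightarrow> continuous_on X f" "\<epsilon> > 0"
  shows "\<exists>\<delta>>0. \<forall>f\<in>F. \<forall>x\<in>X. \<forall>y\<in>X. dist x y < \<delta> \<longrightarrow> \<bar>f x - f y\<bar> < \<epsilon>"
  using assms(1,3)
proof (induction F rule: finite_induct)
  case (insert g F)
  obtain \<delta>1 where 1: "\<delta>1 > 0" "\<forall>f\<in>F. \<forall>x\<in>X. \<forall>y\<in>X. dist x y < \<delta>1 \<longrightarrow> \<bar>f x - f y\<bar> < \<epsilon>"
    using insert by auto
  have "uniformly_continuous_on X g"
    using compact_uniformly_continuous[OF insert.prems[OF insertI1] assms(2)] .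
  then obtain \<delta>2 where 2: "\<delta>2 > 0" "\<forall>x\<in>X. \<forall>y\<in>X. dist x y < \<delta>2 \<longrightarrow> \<bar>g x - g y\<bar> < \<epsilon>"
    using assms(4) by (auto simp: uniformly_continuous_on_def dist_real_def dist_commute abs_minus_commute)
  show ?case using 1 2 by (intro exI[of _ "min \<delta>1 \<delta>2"]) auto
qed (use zero_less_one in blast)

lemma finite_family_bound:
  fixes X :: "'a::metric_space set" and F :: "('a \<Rightarrow> real) set"
  assumes "finite F" "compact X" "\<And>f. f \<in> F \<Longrightarrow> continuous_on X f"
  shows "\<exists>B>0. \<forall>f\<in>F. \<forall>x\<in>X. \<bar>f x\<bar> \<le> B"
  using assms(1,3)
proof (induction F rule: finite_induct)
  case (insert g F)
  obtain B1 where 1: "B1 > 0" "\<forall>f\<in>F. \<forall>x\<in>X. \<bar>f x\<bar> \<le> B1"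
    using insert by auto
  have "bounded (g ` X)"
    using compact_imp_bounded[OF compact_continuous_image[OF insert.prems[OF insertI1] assms(2)]] .
  then obtain B2 where 2: "B2 > 0" "\<forall>x\<in>X. \<bar>g x\<bar> \<le> B2"
    unfolding bounded_pos by auto
  show ?case using 1 2 by (intro exI[of _ "max B1 B2"]) (auto simp: le_max_iff_disj)
qed (use zero_less_one in blast)

lemma compact_finite_net:
  fixes X :: "'a::metric_space set"
  assumes "compact X" "\<delta> > 0"
  obtains K where "finite K" "K \<subseteq> X" "\<And>x. x \<in> X \<Longrightarrow> \<exists>y\<in>K. dist x y < \<delta>"
proof -
  obtain K where K: "finite K" "K \<subseteq> X" "X \<subseteq> (\<Union>x\<in>K. ball x \<delta>)"
    using seq_compact_imp_totally_bounded[OF assms(1)[unfolded compact_eq_seq_compact_metric]] assms(2)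
    by auto
  have "\<exists>y\<in>K. dist x y < \<delta>" if "x \<in> X" for x
  proof -
    obtain y where "y \<in> K" "x \<in> ball y \<delta>" using K(3) \<open>x \<in> X\<close> by blast
    then show ?thesis by (intro bexI[of _ y]) (simp_all add: dist_commute)
  qed
  with K(1,2) that show thesis by blast
qed

text \<open>A partition of \<open>X\<close> into small pieces replaces \<open>M\<close> by finitely
  many weighted points, and repetition in a list expresses weights rounded to multiples of
  \<open>1 / Q\<close>. Equal weights are the form in which the samples can later be spliced into
  one cycle.\<close>

lemma finite_sampling:
  fixes F :: "('a::metric_space \<Rightarrow> real) set"
  assumes "prob_space M" and sets: "sets M = sets (restrict_space borel X)" and X: "compact X"
    and F: "finite F" "\<And>f. f \<in> F \<Longrightarrow> continuous_on X f" and \<epsilon>: "\<epsilon> > 0"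
  shows "\<exists>xs. xs \<noteq> [] \<and> set xs \<subseteq> X \<and>
    (\<forall>f\<in>F. \<bar>sum_list (map f xs) / real (length xs) - (\<integral>x. f x \<partial>M)\<bar> < \<epsilon>)"
proof -
  interpret prob_space M by fact
  have sp: "space M = X"
    using sets_eq_imp_space_eq[OF sets] by (simp add: space_restrict_space)
  obtain B where B: "B > 0" "\<And>f x. f \<in> F \<Longrightarrow> x \<in> X \<Longrightarrow> \<bar>f x\<bar> \<le> B"
    using finite_family_bound[OF F(1) X F(2)] by auto
  have \<epsilon>2: "\<epsilon> / 2 > 0" using \<epsilon> by simp
  obtain \<delta> where \<delta>: "\<delta> > 0"
    "\<And>f x y. f \<in> F \<Longrightarrow> x \<in> X \<Longrightarrow> y \<in> X \<Longrightarrow> dist x y < \<delta> \<Longrightarrow> \<bar>f x - f y\<bar> < \<epsilon> / 2"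
    using finite_family_modulus[OF F(1) X F(2) \<epsilon>2] by auto
  obtain K where K: "finite K" "K \<subseteq> X" "\<And>x. x \<in> X \<Longrightarrow> \<exists>y\<in>K. dist x y < \<delta>"
    using compact_finite_net[OF X \<delta>(1)] by blast
  obtain es where es: "set es = K" using finite_list[OF K(1)] by blast
  define J where "J = length es"
  have es_in: "es ! j \<in> X" if "j < J" for j
    using nth_mem[of j es] that es K(2) unfolding J_def by auto
  obtain x0 where "x0 \<in> X" using not_empty sp by auto
  from K(3)[OF this] have "K \<noteq> {}" by blast
  then have "J > 0" using es unfolding J_def by auto
  \<comment> \<open>Past \<open>J\<close> the sets are empty, so that \<open>disjointed\<close> can
    turn the finite cover by balls into a partition.\<close>
  define U where "U j = (if j < J then ball (es ! j) \<delta> \<inter> X else {})" for j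
  define A where "A = disjointed U"
  have U_sets: "range U \<subseteq> sets M"
  proof -
    have "X \<inter> ball (es ! j) \<delta> \<in> sets M" for j
      unfolding sets sets_restrict_space by (intro imageI) simp
    then show ?thesis unfolding U_def by (auto simp: Int_commute)
  qed
  have A_sets: "A j \<in> sets M" for j
    using sets.range_disjointed_sets[OF U_sets] unfolding A_def by blast
  have A_sub: "A j \<subseteq> U j" for j unfolding A_def by (rule disjointed_subset)
  have UN: "(\<Union>j. A j) = X"
  proof -
    have "X \<subseteq> (\<Union>j. U j)"
    proof
      fix x assume "x \<in> X"
      then obtain y where "y \<in> K" "dist x y < \<delta>" using K(3) by blast
      moreover then obtain j where "j < J" "es ! j = y" using es unfolding J_def by (metis in_set_conv_nth)
      ultimately have "x \<in> U j" using \<open>x \<in> X\<close> by (simp add: U_def dist_commute)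
      then show "x \<in> (\<Union>j. U j)" by blast
    qed
    moreover have "U j \<subseteq> X" for j by (simp add: U_def)
    ultimately show ?thesis unfolding A_def UN_disjointed_eq by blast
  qed
  have pick: "\<exists>j<J. \<forall>i. indicator (A i) x = (if i = j then 1 else (0::real))" if "x \<in> X" for x
  proof -
    obtain j where j: "x \<in> A j" using UN \<open>x \<in> X\<close> by blast
    then have "j < J" using A_sub[of j] by (auto simp: U_def split: if_splits)
    moreover have "x \<notin> A i" if "i \<noteq> j" for i
      using disjoint_family_disjointed[of U] j that unfolding A_def disjoint_family_on_def by blast
    ultimately show ?thesis using j by (intro exI[of _ j]) auto
  qed
  define w where "w j = measure M (A j)" for j
  have w_sum: "(\<Sum>j<J. w j) = 1"
  proof -
    have "(\<Sum>j<J. w j) = (\<integral>x. (\<Sum>j<J. indicator (A j) x) \<partial>M)"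
      using A_sets by (subst Bochner_Integration.integral_sum)
        (auto intro!: integrable_real_indicator simp: emeasure_eq_measure w_def Int_absorb2 sets.sets_into_space)
    also have "\<dots> = (\<integral>x. 1 \<partial>M)"
    proof (rule Bochner_Integration.integral_cong[OF refl])
      fix x assume "x \<in> space M"
      then obtain j where "j < J" "\<forall>i. indicator (A i) x = (if i = j then 1 else (0::real))"
        using pick sp by blast
      then show "(\<Sum>j<J. indicator (A j) x) = (1::real)" by simp
    qed
    finally show ?thesis by (simp add: prob_space)
  qed
  have step: "\<bar>(\<Sum>j<J. w j * f (es ! j)) - (\<integral>x. f x \<partial>M)\<bar> \<le> \<epsilon> / 2" if f: "f \<in> F" for f
  proof -
    have int_f: "integrable M f"
    proof (rule integrable_const_bound[of _ B])
      show "f \<in> borel_measurable M"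
        using borel_measurable_continuous_on_restrict[OF F(2)[OF f]]
        unfolding measurable_cong_sets[OF sets refl] .
      show "AE x in M. norm (f x) \<le> B" using B(2)[OF f] sp by (intro AE_I2) simp
    qed
    have int_h: "integrable M (\<lambda>x. \<Sum>j<J. indicator (A j) x * f (es ! j))"
      using A_sets by (intro Bochner_Integration.integrable_sum integrable_mult_left integrable_real_indicator)
        (simp_all add: emeasure_eq_measure)
    have "(\<Sum>j<J. w j * f (es ! j)) = (\<integral>x. (\<Sum>j<J. indicator (A j) x * f (es ! j)) \<partial>M)"
      using A_sets by (subst Bochner_Integration.integral_sum)
        (auto intro!: integrable_mult_left integrable_real_indicator simp: emeasure_eq_measure w_def Int_absorb2 sets.sets_into_space)
    then have "(\<Sum>j<J. w j * f (es ! j)) - (\<integral>x. f x \<partial>M) =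
        (\<integral>x. (\<Sum>j<J. indicator (A j) x * f (es ! j)) - f x \<partial>M)"
      using int_f int_h by simp
    also have "\<bar>\<dots>\<bar> \<le> (\<integral>x. \<bar>(\<Sum>j<J. indicator (A j) x * f (es ! j)) - f x\<bar> \<partial>M)"
      by (rule integral_abs_bound)
    also have "\<dots> \<le> (\<integral>x. \<epsilon> / 2 \<partial>M)"
    proof (rule integral_mono)
      fix x assume "x \<in> space M"
      then have x: "x \<in> X" using sp by simp
      then obtain j where j: "j < J" "\<forall>i. indicator (A i) x = (if i = j then 1 else (0::real))"
        using pick by blast
      then have "indicator (A j) x = (1::real)" by simp
      then have "x \<in> A j" by (simp add: indicator_eq_1_iff)
      then have "dist x (es ! j) < \<delta>"
        using A_sub[of j] j(1) by (auto simp: U_def dist_commute)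
      then have "\<bar>f x - f (es ! j)\<bar> < \<epsilon> / 2" using \<delta>(2)[OF f x es_in[OF j(1)]] by blast
      moreover have "(\<Sum>j<J. indicator (A j) x * f (es ! j)) = (\<Sum>i<J. if i = j then f (es ! i) else 0)"
        using j(2) by (intro sum.cong) auto
      ultimately show "\<bar>(\<Sum>j<J. indicator (A j) x * f (es ! j)) - f x\<bar> \<le> \<epsilon> / 2"
        using j(1) by (simp add: abs_minus_commute)
    qed (use int_f int_h in simp_all)
    finally show ?thesis by (simp add: prob_space)
  qed
  \<comment> \<open>Rounding down loses at most one copy at each of the \<open>J\<close> points, and
    at most \<open>J\<close> leftover copies go to the first point. The error is thus at most
    \<open>2 * J * B / Q\<close>; the factor \<open>4\<close> brings it below
    \<open>\<epsilon> / 2\<close>.\<close>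
  obtain Q :: nat where Q: "4 * real J * B / \<epsilon> < real Q" using reals_Archimedean2 by blast
  have "0 < 4 * real J * B / \<epsilon>" using \<open>J > 0\<close> B(1) \<epsilon> by simp
  then have Qpos: "real Q > 0" using Q by linarith
  define q where "q j = nat \<lfloor>real Q * w j\<rfloor>" for j
  have q: "real (q j) \<le> real Q * w j" "real Q * w j < real (q j) + 1" for j
  proof -
    have "0 \<le> real Q * w j" unfolding w_def by simp
    then show "real (q j) \<le> real Q * w j" "real Q * w j < real (q j) + 1"
      unfolding q_def by linarith+
  qed
  have qsum: "real (\<Sum>j<J. q j) \<le> real Q" "real Q \<le> real (\<Sum>j<J. q j) + real J"
  proof -
    have "(\<Sum>j<J. real (q j)) \<le> (\<Sum>j<J. real Q * w j)" by (intro sum_mono q)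
    then show "real (\<Sum>j<J. q j) \<le> real Q" by (simp add: w_sum flip: sum_distrib_left)
    have "(\<Sum>j<J. real Q * w j) \<le> (\<Sum>j<J. real (q j) + 1)" by (intro sum_mono less_imp_le q)
    then show "real Q \<le> real (\<Sum>j<J. q j) + real J" by (simp add: w_sum sum.distrib flip: sum_distrib_left)
  qed
  define rest where "rest = Q - (\<Sum>j<J. q j)"
  have rest: "(\<Sum>j<J. q j) + rest = Q" "real rest \<le> real J"
    using qsum unfolding rest_def by linarith+
  define xs where "xs = concat (map (\<lambda>j. replicate (q j) (es ! j)) [0..<J]) @ replicate rest (es ! 0)"
  have sums: "sum_list (map g [0..<J]) = (\<Sum>j<J. g j)" for g :: "nat \<Rightarrow> 'b::comm_monoid_add"
    by (simp add: interv_sum_list_conv_sum_set_nat atLeast0LessThan)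
  have len: "length xs = Q"
    using rest(1) by (simp add: xs_def length_concat comp_def sums)
  have val: "sum_list (map f xs) = (\<Sum>j<J. real (q j) * f (es ! j)) + real rest * f (es ! 0)" for f
  proof -
    have "sum_list (map f (concat (map (\<lambda>j. replicate (q j) (es ! j)) js))) =
        sum_list (map (\<lambda>j. real (q j) * f (es ! j)) js)" for js
      by (induction js) (simp_all add: sum_list_replicate)
    then show ?thesis by (simp add: xs_def sums sum_list_replicate)
  qed
  show ?thesis
  proof (intro exI[of _ xs] conjI ballI)
    show "xs \<noteq> []" using len Qpos by auto
    show "set xs \<subseteq> X" unfolding xs_def using es_in \<open>J > 0\<close> by auto
    fix f assume f: "f \<in> F"
    have "\<bar>sum_list (map f xs) - real Q * (\<Sum>j<J. w j * f (es ! j))\<bar> =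
       \<bar>(\<Sum>j<J. (real (q j) - real Q * w j) * f (es ! j)) + real rest * f (es ! 0)\<bar>"
      by (simp add: val sum_distrib_left sum_subtractf algebra_simps)
    also have "\<dots> \<le> \<bar>\<Sum>j<J. (real (q j) - real Q * w j) * f (es ! j)\<bar> + \<bar>real rest * f (es ! 0)\<bar>"
      by (rule abs_triangle_ineq)
    also have "\<dots> \<le> (\<Sum>j<J. B) + real J * B"
    proof (rule add_mono)
      show "\<bar>\<Sum>j<J. (real (q j) - real Q * w j) * f (es ! j)\<bar> \<le> (\<Sum>j<J. B)"
      proof (rule order_trans[OF sum_abs sum_mono])
        fix j assume "j \<in> {..<J}"
        then have "\<bar>f (es ! j)\<bar> \<le> B" using B(2)[OF f] es_in by simp
        moreover have "\<bar>real (q j) - real Q * w j\<bar> \<le> 1" using q[of j] by linarith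
        ultimately have "\<bar>real (q j) - real Q * w j\<bar> * \<bar>f (es ! j)\<bar> \<le> 1 * B"
          by (intro mult_mono) auto
        then show "\<bar>(real (q j) - real Q * w j) * f (es ! j)\<bar> \<le> B" by (simp add: abs_mult)
      qed
      have "real rest * \<bar>f (es ! 0)\<bar> \<le> real J * B"
        using rest(2) B(2)[OF f es_in[OF \<open>J > 0\<close>]] by (intro mult_mono) auto
      then show "\<bar>real rest * f (es ! 0)\<bar> \<le> real J * B" by (simp add: abs_mult)
    qed
    also have "\<dots> = 2 * real J * B" by simp
    finally have "\<bar>sum_list (map f xs) - real Q * (\<Sum>j<J. w j * f (es ! j))\<bar> / real Q \<le> 2 * real J * B / real Q"
      using Qpos by (simp add: divide_right_mono)
    moreover have "sum_list (map f xs) / real Q - (\<Sum>j<J. w j * f (es ! j)) =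
        (sum_list (map f xs) - real Q * (\<Sum>j<J. w j * f (es ! j))) / real Q"
      using Qpos by (simp add: field_simps)
    then have "\<bar>sum_list (map f xs) / real Q - (\<Sum>j<J. w j * f (es ! j))\<bar> =
        \<bar>sum_list (map f xs) - real Q * (\<Sum>j<J. w j * f (es ! j))\<bar> / real Q"
      by (simp only: abs_divide abs_of_nat)
    moreover have "2 * real J * B / real Q < \<epsilon> / 2"
      using Q Qpos \<epsilon> by (simp add: field_simps)
    ultimately have "\<bar>sum_list (map f xs) / real Q - (\<Sum>j<J. w j * f (es ! j))\<bar> < \<epsilon> / 2"
      by linarith
    then show "\<bar>sum_list (map f xs) / real (length xs) - (\<integral>x. f x \<partial>M)\<bar> < \<epsilon>"
      using step[OF f] unfolding len by linarith
  qed
qed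

section \<open>Chains of bounded length\<close>

text \<open>Chains are glued at a shared entry: the goal of the first is the start of the second and
  is kept only once.\<close>

lemma successively_append_hd:
  "successively P (xs @ [hd ys]) \<Longrightarrow> successively P ys \<Longrightarrow> successively P (xs @ ys)"
  by (auto simp: successively_append_iff)

lemma successively_append_last:
  "xs \<noteq> [] \<Longrightarrow> successively P xs \<Longrightarrow> successively P (last xs # ys) \<Longrightarrow> successively P (xs @ ys)"
  by (auto simp: successively_append_iff successively_Cons)

lemma abs_sum_list_le:
  fixes g :: "'a \<Rightarrow> real"
  assumes "\<And>x. x \<in> set xs \<Longrightarrow> \<bar>g x\<bar> \<le> B"
  shows "\<bar>sum_list (map g xs)\<bar> \<le> B * real (length xs)"
  using assms
proof (induction xs)
  case (Cons y ys)
  then have "\<bar>g y\<bar> \<le> B" "\<bar>sum_list (map g ys)\<bar> \<le> B * real (length ys)" by auto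
  then show ?case by (simp add: algebra_simps)
qed simp

context compact_dynamics begin

abbreviation chain :: "real \<Rightarrow> 'a list \<Rightarrow> bool" where
  "chain \<delta> \<equiv> successively (\<lambda>x y. dist (T x) y < \<delta>)"

definition segment :: "nat \<Rightarrow> 'a \<Rightarrow> 'a list" where
  "segment n x = map (\<lambda>i. (T ^^ i) x) [0..<Suc n]"

lemma segment_simps [simp]:
  "segment n x \<noteq> []" "hd (segment n x) = x" "last (segment n x) = (T ^^ n) x"
  "length (segment n x) = Suc n"
  by (simp_all add: segment_def hd_map del: upt_Suc) (simp add: last_map)

lemma segment_into: "x \<in> X \<Longrightarrow> set (segment n x) \<subseteq> X"
  by (auto simp: segment_def funpow_into)

lemma nth_segment: "i \<le> n \<Longrightarrow> segment n x ! i = (T ^^ i) x"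
  by (simp add: segment_def del: upt_Suc)

lemma segment_Suc: "segment (Suc n) x = segment n x @ [(T ^^ Suc n) x]"
  by (simp add: segment_def)

lemma chain_segment: "\<delta> > 0 \<Longrightarrow> chain \<delta> (segment n x)"
proof (induction n)
  case (Suc n)
  then show ?case unfolding segment_Suc by (simp add: successively_append_iff)
qed (simp add: segment_def)

text \<open>Compactness makes the lengths uniform: only the finitely many pairs of points of a
  \<open>\<delta> / 2\<close>-net have to be linked, and a further \<open>\<delta> / 2\<close> is
  spent on passing between the actual endpoints and the net.\<close>

lemma bounded_chain:
  assumes trans: "transitive_system X T" and \<delta>: "\<delta> > 0"
  obtains C where "\<And>u v. u \<in> X \<Longrightarrow> v \<in> X \<Longrightarrow>
    \<exists>c. set c \<subseteq> X \<and> length c \<le> C \<and> chain \<delta> (u # c @ [v])"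
proof -
  have \<delta>2: "\<delta> / 2 > 0" using \<delta> by simp
  obtain K where K: "finite K" "K \<subseteq> X" "\<And>x. x \<in> X \<Longrightarrow> \<exists>y\<in>K. dist x y < \<delta> / 2"
    using compact_finite_net[OF compact_space \<delta>2] by blast
  \<comment> \<open>The exponent is \<open>Suc n\<close> because the last application of
    \<open>T\<close> belongs to the jump into \<open>v\<close>; the inserted piece ends at the
    \<open>n\<close>-th iterate. Transitivity supplies a positive time, so such an \<open>n\<close>
    exists.\<close>
  define link where "link e e' n p \<longleftrightarrow> p \<in> X \<and> dist e p < \<delta> / 2 \<and> dist e' ((T ^^ Suc n) p) < \<delta> / 2"
    for e e' n p
  have ex: "\<exists>n p. link e e' n p" if "e \<in> K" "e' \<in> K" for e e'
  proof -
    let ?U = "X \<inter> ball e (\<delta> / 2)" and ?V = "X \<inter> ball e' (\<delta> / 2)"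
    have "openin (top_of_set X) ?U" "openin (top_of_set X) ?V"
      by (simp_all add: openin_open_Int)
    moreover have "e \<in> ?U" "e' \<in> ?V" using that K(2) \<delta> by auto
    then have "?U \<noteq> {}" "?V \<noteq> {}" by blast+
    ultimately obtain n where "n > 0" "(T ^^ n) ` ?U \<inter> ?V \<noteq> {}"
      using trans[unfolded transitive_system_def, rule_format, of ?U ?V] by auto
    then obtain p where "p \<in> X" "p \<in> ball e (\<delta> / 2)" "(T ^^ n) p \<in> ball e' (\<delta> / 2)"
      by auto
    with \<open>n > 0\<close> show ?thesis
      by (intro exI[of _ "n - 1"] exI[of _ p]) (simp add: link_def)
  qed
  define n where "n e e' = (SOME n. \<exists>p. link e e' n p)" for e e'
  define p where "p e e' = (SOME p. link e e' (n e e') p)" for e e'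
  have link: "link e e' (n e e') (p e e')" if "e \<in> K" "e' \<in> K" for e e'
    unfolding p_def n_def using someI_ex[OF someI_ex[OF ex[OF that]]] .
  have np: "p e e' \<in> X" "dist e (p e e') < \<delta> / 2" "dist e' ((T ^^ Suc (n e e')) (p e e')) < \<delta> / 2"
    if "e \<in> K" "e' \<in> K" for e e'
    using link[OF that] unfolding link_def by simp_all
  define C where "C = (\<Sum>(e, e')\<in>K \<times> K. Suc (n e e'))"
  show thesis
  proof (rule that)
    fix u v assume uv: "u \<in> X" "v \<in> X"
    obtain e where e: "e \<in> K" "dist (T u) e < \<delta> / 2" using K(3)[OF T_into[OF uv(1)]] by blast
    obtain e' where e': "e' \<in> K" "dist v e' < \<delta> / 2" using K(3)[OF uv(2)] by blast
    let ?c = "segment (n e e') (p e e')"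
    have "dist (T u) (p e e') < \<delta>"
      using dist_triangle[of "T u" "p e e'" e] e(2) np(2)[OF e(1) e'(1)] by linarith
    moreover have "dist (T ((T ^^ n e e') (p e e'))) v < \<delta>"
      using dist_triangle3[of "T ((T ^^ n e e') (p e e'))" v e'] e'(2) np(3)[OF e(1) e'(1)]
      by (simp add: dist_commute)
    ultimately have "chain \<delta> (u # ?c @ [v])"
      using chain_segment[OF \<delta>] by (simp add: successively_Cons successively_append_iff)
    moreover have "length ?c \<le> C"
      using member_le_sum[of "(e, e')" "K \<times> K" "\<lambda>(e, e'). Suc (n e e')"] e(1) e'(1) K(1)
      unfolding C_def by auto
    ultimately show "\<exists>c. set c \<subseteq> X \<and> length c \<le> C \<and> chain \<delta> (u # c @ [v])"
      using segment_into[OF np(1)[OF e(1) e'(1)]] by blast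
  qed
qed

text \<open>Each connection is made to run through the first iterates of \<open>a\<close>, at a cost
  independent of the endpoints. Every cycle built from such connections then contains the segment
  that bounds the atoms.\<close>

lemma bounded_chain_through:
  assumes trans: "transitive_system X T" and \<delta>: "\<delta> > 0" and a: "a \<in> X"
  obtains C where "\<forall>u\<in>X. \<forall>v\<in>X. \<exists>p s. set (p @ segment k a @ s) \<subseteq> X \<and> length (p @ segment k a @ s) \<le> C \<and>
      chain \<delta> (u # (p @ segment k a @ s) @ [v])"
proof -
  obtain C where C: "\<And>u v. u \<in> X \<Longrightarrow> v \<in> X \<Longrightarrow>
    \<exists>c. set c \<subseteq> X \<and> length c \<le> C \<and> chain \<delta> (u # c @ [v])"
    using bounded_chain[OF trans \<delta>] by blast
  show thesis
  proof (rule that[of "2 * C + Suc k"], intro ballI)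
    fix u v assume uv: "u \<in> X" "v \<in> X"
    obtain p where p: "set p \<subseteq> X" "length p \<le> C" "chain \<delta> (u # p @ [a])"
      using C[OF uv(1) a] by blast
    obtain s where s: "set s \<subseteq> X" "length s \<le> C" "chain \<delta> ((T ^^ k) a # s @ [v])"
      using C[OF funpow_into[OF a] uv(2)] by blast
    have "chain \<delta> (u # (p @ segment k a @ s) @ [v])"
      using successively_append_hd[of _ "u # p" "segment k a @ s @ [v]"] p(3)
        successively_append_last[OF _ chain_segment[OF \<delta>, of k a], of "s @ [v]"] s(3)
      by simp
    then show "\<exists>p s. set (p @ segment k a @ s) \<subseteq> X \<and> length (p @ segment k a @ s) \<le> 2 * C + Suc k \<and>
      chain \<delta> (u # (p @ segment k a @ s) @ [v])"
      using p(1,2) s(1,2) segment_into[OF a, of k]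
      by (intro exI[of _ p] exI[of _ s]) simp
  qed
qed

text \<open>Each sample point is followed for \<open>Suc l\<close> steps before a connector leads
  on, so only the connectors, at most \<open>C\<close> entries per block, disturb the sums. The goal
  \<open>v\<close> is left open and later becomes the first sample point, which closes the cycle.
  The estimate is quantified over \<open>f\<close> and \<open>B\<close> so that one \<open>w\<close>
  serves a whole family.\<close>

lemma concatenated_chain:
  assumes \<delta>: "\<delta> > 0"
    and C: "\<forall>u\<in>X. \<forall>v\<in>X. \<exists>p s. set (p @ segment k a @ s) \<subseteq> X \<and> length (p @ segment k a @ s) \<le> C \<and>
      chain \<delta> (u # (p @ segment k a @ s) @ [v])"
    and "set xs \<subseteq> X" "v \<in> X"
  shows "\<exists>w. set w \<subseteq> X \<and> chain \<delta> (w @ [v]) \<and> hd (w @ [v]) = hd (xs @ [v]) \<and>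
    length xs * Suc l \<le> length w \<and> length w \<le> length xs * (Suc l + C) \<and>
    (xs \<noteq> [] \<longrightarrow> (\<exists>p s. w = p @ segment k a @ s)) \<and>
    (\<forall>f B. (\<forall>x\<in>X. \<bar>f x\<bar> \<le> B) \<longrightarrow>
      \<bar>sum_list (map f w) - sum_list (map (\<lambda>x. \<Sum>i<Suc l. f ((T ^^ i) x)) xs)\<bar>
        \<le> B * real (length w - length xs * Suc l))"
  using assms(3)
proof (induction xs)
  case (Cons x xs)
  then have "set xs \<subseteq> X" by simp
  from Cons.IH[OF this] obtain w where w: "set w \<subseteq> X" "chain \<delta> (w @ [v])" "hd (w @ [v]) = hd (xs @ [v])"
    "length xs * Suc l \<le> length w" "length w \<le> length xs * (Suc l + C)"
    "\<forall>f B. (\<forall>x\<in>X. \<bar>f x\<bar> \<le> B) \<longrightarrow>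
      \<bar>sum_list (map f w) - sum_list (map (\<lambda>x. \<Sum>i<Suc l. f ((T ^^ i) x)) xs)\<bar>
        \<le> B * real (length w - length xs * Suc l)"
    by (elim exE conjE) (rule that)
  have x: "x \<in> X" using Cons.prems by simp
  \<comment> \<open>The connector aims at the head of \<open>w\<close>, or at \<open>v\<close>
    itself behind the last block, where \<open>w\<close> is empty.\<close>
  have "hd (w @ [v]) \<in> X" using w(1) \<open>v \<in> X\<close> by (cases w) auto
  from C[rule_format, OF funpow_into[OF x] this] obtain p s where
    ps: "set (p @ segment k a @ s) \<subseteq> X" "length (p @ segment k a @ s) \<le> C"
      "chain \<delta> ((T ^^ l) x # (p @ segment k a @ s) @ [hd (w @ [v])])" by blast
  define c where "c = p @ segment k a @ s"
  have c: "set c \<subseteq> X" "length c \<le> C" "chain \<delta> ((T ^^ l) x # c @ [hd (w @ [v])])"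
    using ps unfolding c_def by auto
  show ?case
  proof (rule exI[of _ "segment l x @ c @ w"], intro conjI allI impI)
    show "set (segment l x @ c @ w) \<subseteq> X" using segment_into[OF x] c(1) w(1) by auto
    have "chain \<delta> (segment l x @ c @ (w @ [v]))"
      using successively_append_hd[of _ "(T ^^ l) x # c" "w @ [v]"] c(3) w(2)
        successively_append_last[OF _ chain_segment[OF \<delta>, of l x], of "c @ w @ [v]"]
      by simp
    then show "chain \<delta> ((segment l x @ c @ w) @ [v])" by simp
    show "hd ((segment l x @ c @ w) @ [v]) = hd ((x # xs) @ [v])" by simp
    show "length (x # xs) * Suc l \<le> length (segment l x @ c @ w)" using w(4) by simp
    show "length (segment l x @ c @ w) \<le> length (x # xs) * (Suc l + C)" using w(5) c(2) by simp
    show "\<exists>p s. segment l x @ c @ w = p @ segment k a @ s"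
      unfolding c_def by (intro exI[of _ "segment l x @ p"] exI[of _ "s @ w"]) simp
    fix f :: "'a \<Rightarrow> real" and B assume B: "\<forall>x\<in>X. \<bar>f x\<bar> \<le> B"
    have seg: "sum_list (map f (segment l x)) = (\<Sum>i<Suc l. f ((T ^^ i) x))"
      by (simp add: segment_def comp_def interv_sum_list_conv_sum_set_nat atLeast0LessThan del: upt_Suc sum.lessThan_Suc)
    have "\<bar>sum_list (map f c)\<bar> \<le> B * real (length c)"
      using c(1) B by (intro abs_sum_list_le) blast
    moreover have "real (length (segment l x @ c @ w) - length (x # xs) * Suc l) =
        real (length c) + real (length w - length xs * Suc l)"
      using w(4) by simp
    ultimately show "\<bar>sum_list (map f (segment l x @ c @ w)) -
        sum_list (map (\<lambda>x. \<Sum>i<Suc l. f ((T ^^ i) x)) (x # xs))\<bar>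
        \<le> B * real (length (segment l x @ c @ w) - length (x # xs) * Suc l)"
      using mp[OF spec[OF spec[OF w(6), of f], of B] B] by (simp add: seg distrib_left del: sum.lessThan_Suc mult_Suc_right)
  qed
qed (use \<open>v \<in> X\<close> in auto)

text \<open>
  Otherwise some iterate \<open>T\<^sup>m\<close> is the identity, and transitivity forces \<open>X\<close> to be a single finite orbit.
\<close>

lemma exists_point_without_small_period:
  assumes trans: "transitive_system X T" and inf: "infinite X"
  shows "\<exists>a\<in>X. \<forall>P. 0 < P \<and> P \<le> k \<longrightarrow> (T ^^ P) a \<noteq> a"
proof (rule ccontr)
  assume "\<not> ?thesis"
  then have per: "\<exists>P. 0 < P \<and> P \<le> k \<and> (T ^^ P) a = a" if "a \<in> X" for a using that by blast
  \<comment> \<open>A common multiple of all periods up to \<open>k\<close>, so that a single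
    iterate fixes every point.\<close>
  define m where "m = (fact k :: nat)"
  have m: "m > 0" by (simp add: m_def)
  have fix_m: "(T ^^ m) a = a" if a: "a \<in> X" for a
  proof -
    obtain P where P: "0 < P" "P \<le> k" "(T ^^ P) a = a" using per[OF a] by blast
    have "m mod P = 0" using P dvd_fact[of P k] by (simp add: m_def dvd_eq_mod_eq_0)
    then show ?thesis using funpow_mod_eq[OF P(3), of m] by simp
  qed
  obtain x where x: "x \<in> X" using inf by (metis ex_in_conv finite.emptyI)
  have "finite ((\<lambda>i. (T ^^ i) x) ` {..<m})" by simp
  then obtain y where y: "y \<in> X" "y \<notin> (\<lambda>i. (T ^^ i) x) ` {..<m}"
    using inf by (metis finite_subset subsetI)
  obtain e where e: "e > 0" "\<And>p. p \<in> (\<lambda>i. (T ^^ i) x) ` {..<m} \<Longrightarrow> p \<noteq> y \<Longrightarrow> e \<le> dist y p"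
    using finite_set_avoid[OF \<open>finite ((\<lambda>i. (T ^^ i) x) ` {..<m})\<close>, of y] by metis
  have far: "e \<le> dist y ((T ^^ i) x)" if "i < m" for i
    using e(2)[of "(T ^^ i) x"] y(2) that by auto
  \<comment> \<open>Near \<open>x\<close> the first \<open>m\<close> iterates stay close to those of
    \<open>x\<close>, and since \<open>T ^^ m\<close> fixes every point no others occur. Hence the
    ball around \<open>x\<close> never reaches the ball around \<open>y\<close>.\<close>
  have "\<exists>d>0. \<forall>u\<in>X. dist u x < d \<longrightarrow> (\<forall>i<j. dist ((T ^^ i) u) ((T ^^ i) x) < e / 2)" for j
  proof (induction j)
    case (Suc j)
    then obtain d1 where d1: "d1 > 0" "\<forall>u\<in>X. dist u x < d1 \<longrightarrow> (\<forall>i<j. dist ((T ^^ i) u) ((T ^^ i) x) < e / 2)"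
      by blast
    have "e / 2 > 0" using e(1) by simp
    then obtain d2 where d2: "d2 > 0" "\<forall>u\<in>X. dist u x < d2 \<longrightarrow> dist ((T ^^ j) u) ((T ^^ j) x) < e / 2"
      using continuous_funpow[of j] x unfolding continuous_on_iff by blast
    show ?case
      using d1 d2 by (intro exI[of _ "min d1 d2"]) (auto simp: less_Suc_eq)
  qed (auto intro: exI[of _ 1])
  then obtain d where d: "d > 0"
    "\<And>u i. u \<in> X \<Longrightarrow> dist u x < d \<Longrightarrow> i < m \<Longrightarrow> dist ((T ^^ i) u) ((T ^^ i) x) < e / 2"
    by blast
  have "openin (top_of_set X) (X \<inter> ball x d)" "openin (top_of_set X) (X \<inter> ball y (e / 2))"
    by (simp_all add: openin_open_Int)
  moreover have "x \<in> X \<inter> ball x d" "y \<in> X \<inter> ball y (e / 2)" using x y d(1) e(1) by auto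
  then have "X \<inter> ball x d \<noteq> {}" "X \<inter> ball y (e / 2) \<noteq> {}" by blast+
  ultimately obtain n where "(T ^^ n) ` (X \<inter> ball x d) \<inter> (X \<inter> ball y (e / 2)) \<noteq> {}"
    using trans[unfolded transitive_system_def, rule_format, of "X \<inter> ball x d" "X \<inter> ball y (e / 2)"] by auto
  then obtain u where u: "u \<in> X" "dist u x < d" "dist y ((T ^^ n) u) < e / 2"
    by (auto simp: dist_commute)
  have "(T ^^ n) u = (T ^^ (n mod m)) u" using funpow_mod_eq[OF fix_m[OF u(1)], of n] by simp
  moreover have "n mod m < m" using m by simp
  ultimately show False
    using d(2)[OF u(1,2), of "n mod m"] far[of "n mod m"] u(3)
      dist_triangle[of y "(T ^^ (n mod m)) x" "(T ^^ (n mod m)) u"] by simp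
qed

end

section \<open>Cycles whose averages imitate an invariant measure\<close>

lemma sum_periodic_shift:
  fixes g :: "nat \<Rightarrow> real"
  assumes "\<And>n. g (n + N) = g n"
  shows "(\<Sum>n<N. g (s + n)) = (\<Sum>n<N. g n)"
proof (induction s)
  case (Suc s)
  have "(\<Sum>n<Suc N. g (s + n)) = g (s + 0) + (\<Sum>n<N. g (s + Suc n))"
    by (rule sum.lessThan_Suc_shift)
  then show ?case using Suc assms[of s] by simp
qed simp

context compact_dynamics begin

lemma abs_bavg_le:
  assumes "\<And>x. x \<in> X \<Longrightarrow> \<bar>f x\<bar> \<le> B" "x \<in> X" "n > 0"
  shows "\<bar>bavg n f x\<bar> \<le> B"
proof -
  have "\<bar>\<Sum>i<n. f ((T ^^ i) x)\<bar> \<le> (\<Sum>i<n. B)"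
    by (rule order_trans[OF sum_abs sum_mono]) (use assms funpow_into in auto)
  then show ?thesis using assms(3) by (simp add: bavg_def field_simps)
qed

text \<open>Sampling is applied to \<open>bavg L f\<close> instead of \<open>f\<close>: by
  invariance of \<open>\<mu>\<close> the integral is the same, and each sample then stands for an
  orbit segment of length \<open>L\<close>. The connectors, at most \<open>C\<close> entries per
  segment, become negligible for large \<open>L\<close>.\<close>

lemma cycle_near_measure:
  fixes F :: "('a \<Rightarrow> real) set"
  assumes trans: "transitive_system X T" and \<delta>: "\<delta> > 0" and a: "a \<in> X" and \<mu>: "\<mu> \<in> MX"
    and F: "finite F" "\<And>f. f \<in> F \<Longrightarrow> continuous_on X f" and \<epsilon>: "\<epsilon> > 0"
  shows "\<exists>N z. N > 0 \<and> (\<forall>n. z (n + N) = z n) \<and> pseudo_orbit X T \<delta> z \<and>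
    (\<exists>j. \<forall>i\<le>k. z (j + i) = (T ^^ i) a) \<and>
    (\<forall>f\<in>F. \<bar>(\<Sum>n<N. f (z n)) / real N - (\<integral>x. f x \<partial>\<mu>)\<bar> < \<epsilon>)"
proof -
  obtain B where B: "B > 0" "\<And>f x. f \<in> F \<Longrightarrow> x \<in> X \<Longrightarrow> \<bar>f x\<bar> \<le> B"
    using finite_family_bound[OF F(1) compact_space F(2)] by auto
  obtain C where C: "\<forall>u\<in>X. \<forall>v\<in>X. \<exists>p s. set (p @ segment k a @ s) \<subseteq> X \<and> length (p @ segment k a @ s) \<le> C \<and>
      chain \<delta> (u # (p @ segment k a @ s) @ [v])"
    using bounded_chain_through[OF trans \<delta> a] by blast
  \<comment> \<open>The connectors cost at most \<open>2 * C * B / L\<close>: once for their own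
    values, once because the sum is divided by \<open>N\<close> and not by \<open>Q * L\<close>.
    This has to fall below \<open>\<epsilon> / 2\<close>.\<close>
  obtain l :: nat where l: "4 * real C * B / \<epsilon> < real l" using reals_Archimedean2 by blast
  define L where "L = Suc l"
  have "4 * real C * B / \<epsilon> < real L" using l by (simp add: L_def)
  then have L: "2 * real C * B / real L < \<epsilon> / 2"
    using \<epsilon> by (simp add: L_def field_simps)
  have "\<exists>xs. xs \<noteq> [] \<and> set xs \<subseteq> X \<and>
    (\<forall>g\<in>bavg L ` F. \<bar>sum_list (map g xs) / real (length xs) - (\<integral>x. g x \<partial>\<mu>)\<bar> < \<epsilon> / 2)"
    by (rule finite_sampling[OF MX_D(1,2)[OF \<mu>] compact_space])
      (use F \<epsilon> continuous_bavg in auto)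
  then obtain xs where xs: "xs \<noteq> []" "set xs \<subseteq> X"
    "\<And>f. f \<in> F \<Longrightarrow> \<bar>sum_list (map (bavg L f) xs) / real (length xs) - (\<integral>x. bavg L f x \<partial>\<mu>)\<bar> < \<epsilon> / 2"
    by blast
  define v where "v = hd xs"
  have v: "v \<in> X" using xs(1,2) hd_in_set unfolding v_def by blast
  obtain w where w: "set w \<subseteq> X" "chain \<delta> (w @ [v])" "hd (w @ [v]) = hd (xs @ [v])"
    "length xs * Suc l \<le> length w" "length w \<le> length xs * (Suc l + C)"
    "xs \<noteq> [] \<longrightarrow> (\<exists>p s. w = p @ segment k a @ s)"
    "\<forall>f B. (\<forall>x\<in>X. \<bar>f x\<bar> \<le> B) \<longrightarrow>
      \<bar>sum_list (map f w) - sum_list (map (\<lambda>x. \<Sum>i<Suc l. f ((T ^^ i) x)) xs)\<bar>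
        \<le> B * real (length w - length xs * Suc l)"
    using concatenated_chain[OF \<delta> C xs(2) v, of l] by (elim exE conjE) (rule that)
  define N where "N = length w"
  define Q where "Q = length xs"
  have Q: "Q > 0" using xs(1) by (simp add: Q_def)
  have NQ: "Q * L \<le> N" "N \<le> Q * (L + C)" using w(4,5) by (simp_all add: N_def Q_def L_def)
  have "0 < Q * L" using Q by (simp add: L_def)
  then have N: "N > 0" using NQ(1) by linarith
  then have w_ne: "w \<noteq> []" by (auto simp: N_def)
  \<comment> \<open>The word begins at the goal \<open>v\<close> of its last jump, so the return
    from its last entry to its first is a chain step too.\<close>
  have hd_w: "w ! 0 = v" using w(3) w_ne xs(1) by (simp add: hd_append v_def flip: hd_conv_nth)
  define z where "z n = w ! (n mod N)" for n
  have z_in: "z n \<in> X" for n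
    using w(1) nth_mem[of "n mod N" w] N unfolding z_def N_def by auto
  have orbit: "dist (T (z n)) (z (Suc n)) < \<delta>" for n
  proof -
    have m: "n mod N < N" using N by simp
    have "dist (T ((w @ [v]) ! (n mod N))) ((w @ [v]) ! Suc (n mod N)) < \<delta>"
      using successively_nth[OF w(2), of "n mod N"] m by (simp add: N_def)
    moreover have "(w @ [v]) ! (n mod N) = z n" using m by (simp add: z_def nth_append N_def)
    moreover have "(w @ [v]) ! Suc (n mod N) = z (Suc n)"
      using m hd_w by (auto simp: z_def nth_append mod_Suc N_def)
    ultimately show ?thesis by simp
  qed
  show ?thesis
  proof (rule exI[of _ N], rule exI[of _ z], intro conjI allI ballI N)
    show "z (n + N) = z n" for n by (simp add: z_def)
    show "pseudo_orbit X T \<delta> z" using z_in orbit by (simp add: pseudo_orbit_def)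
    obtain p s where ps: "w = p @ segment k a @ s" using w(6) xs(1) by blast
    have "z (length p + i) = (T ^^ i) a" if "i \<le> k" for i
    proof -
      have "length p + i < N" using that by (simp add: N_def ps)
      then show ?thesis using that by (simp add: z_def ps nth_append nth_segment)
    qed
    then show "\<exists>j. \<forall>i\<le>k. z (j + i) = (T ^^ i) a" by blast
    fix f assume f: "f \<in> F"
    have "integrable \<mu> f" by (rule integrable_continuous[OF MX_D(1,2)[OF \<mu>] F(2)[OF f]])
    then have int: "(\<integral>x. bavg L f x \<partial>\<mu>) = (\<integral>x. f x \<partial>\<mu>)"
      by (rule integral_bavg(2)[OF \<mu>]) (simp add: L_def)
    define S where "S = (\<Sum>n<N. f (z n))"
    define A where "A = sum_list (map (bavg L f) xs) / real Q"
    have S: "S = sum_list (map f w)"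
      unfolding S_def by (simp add: sum_list_sum_nth z_def N_def atLeast0LessThan)
    have "sum_list (map (\<lambda>x. \<Sum>i<Suc l. f ((T ^^ i) x)) xs) = real L * sum_list (map (bavg L f) xs)"
      by (simp add: bavg_def L_def flip: sum_list_const_mult del: sum.lessThan_Suc)
    also have "\<dots> = real Q * real L * A" using Q by (simp add: A_def)
    finally have "\<bar>S - real Q * real L * A\<bar> \<le> B * real (N - Q * L)"
      using mp[OF spec[OF spec[OF w(7), of f], of B]] B(2)[OF f] by (simp add: S N_def Q_def L_def del: mult_Suc_right sum.lessThan_Suc)
    then have SA: "\<bar>S - real Q * real L * A\<bar> \<le> B * (real N - real Q * real L)"
      using NQ(1) by (simp add: of_nat_diff)
    have "\<bar>sum_list (map (bavg L f) xs)\<bar> \<le> B * real Q"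
      unfolding Q_def using xs(2) by (intro abs_sum_list_le abs_bavg_le) (auto simp: L_def B(2)[OF f])
    then have "\<bar>A\<bar> \<le> B" using Q by (simp add: A_def field_simps)
    have le: "real Q * real L \<le> real N" "real N \<le> real Q * (real L + real C)"
      using NQ by (simp_all flip: of_nat_mult of_nat_add)
    have "\<bar>(real N - real Q * real L) * A\<bar> \<le> (real N - real Q * real L) * B"
      using le(1) \<open>\<bar>A\<bar> \<le> B\<close> by (simp add: abs_mult mult_left_mono)
    then have "\<bar>S - real N * A\<bar> \<le> 2 * B * (real N - real Q * real L)"
      using SA by (simp add: algebra_simps)
    also have "\<dots> \<le> 2 * B * (real Q * real C)"
      using le(2) B(1) by (intro mult_left_mono) (simp_all add: algebra_simps)
    finally have "\<bar>S - real N * A\<bar> / real N \<le> 2 * B * (real Q * real C) / real N"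
      by (rule divide_right_mono) simp
    also have "\<dots> \<le> 2 * B * (real Q * real C) / (real Q * real L)"
      using le(1) B(1) N Q by (intro divide_left_mono) (auto simp: L_def)
    also have "\<dots> = 2 * real C * B / real L" using Q by simp
    finally have "\<bar>S - real N * A\<bar> / real N < \<epsilon> / 2" using L by linarith
    moreover have "S / real N - A = (S - real N * A) / real N" using N by (simp add: field_simps)
    then have "\<bar>S / real N - A\<bar> = \<bar>S - real N * A\<bar> / real N" by (simp only: abs_divide abs_of_nat)
    ultimately have "\<bar>S / real N - A\<bar> < \<epsilon> / 2" by simp
    moreover have "\<bar>A - (\<integral>x. f x \<partial>\<mu>)\<bar> < \<epsilon> / 2"
      using xs(3)[OF f] unfolding int by (simp add: A_def Q_def)
    ultimately have "\<bar>S / real N - A\<bar> + \<bar>A - (\<integral>x. f x \<partial>\<mu>)\<bar> < \<epsilon>" by simp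
    moreover have "\<bar>S / real N - (\<integral>x. f x \<partial>\<mu>)\<bar> \<le> \<bar>S / real N - A\<bar> + \<bar>A - (\<integral>x. f x \<partial>\<mu>)\<bar>"
      using abs_triangle_ineq[of "S / real N - A" "A - (\<integral>x. f x \<partial>\<mu>)"] by simp
    ultimately show "\<bar>(\<Sum>n<N. f (z n)) / real N - (\<integral>x. f x \<partial>\<mu>)\<bar> < \<epsilon>"
      unfolding S_def by (rule le_less_trans[rotated])
  qed
qed

end

section \<open>Approximation of invariant measures\<close>

context compact_dynamics begin

section \<open>Sizes of atoms of invariant measures\<close>

lemma MX_singleton:
  assumes "\<mu> \<in> MX" "x \<in> X" shows "{x} \<in> sets \<mu>"
proof -
  have "X \<inter> {x} \<in> sets (restrict_space borel X)"
    unfolding sets_restrict_space by (intro imageI) simp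
  then show ?thesis using assms(2) by (simp add: MX_D(2)[OF assms(1)] Int_absorb1)
qed

text \<open>\<open>{x}\<close> lies in the preimage of \<open>{T x}\<close>, which has the mass of
  \<open>{T x}\<close>. Several points may share an image, so equality can fail, but the inequality
  points in the useful direction: an atom is bounded by its forward orbit.\<close>

lemma measure_singleton_le_image:
  assumes \<mu>: "\<mu> \<in> MX" and x: "x \<in> X"
  shows "measure \<mu> {x} \<le> measure \<mu> {(T ^^ n) x}"
proof (induction n)
  case (Suc n)
  interpret prob_space \<mu> by (rule MX_D(1)[OF \<mu>])
  let ?y = "(T ^^ n) x"
  have y: "?y \<in> X" by (rule funpow_into[OF x])
  have s: "{T ?y} \<in> sets \<mu>" by (rule MX_singleton[OF \<mu> T_into[OF y]])
  have "T -` {T ?y} \<inter> X \<in> sets \<mu>"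
    using measurable_sets[OF measurable_T[OF MX_D(2)[OF \<mu>]] s] MX_D(3)[OF \<mu>] by simp
  then have "measure \<mu> {?y} \<le> measure \<mu> (T -` {T ?y} \<inter> X)"
    using y by (intro finite_measure_mono) auto
  also have "\<dots> = measure \<mu> {T ?y}" using MX_D(4)[OF \<mu> s] by (simp add: measure_def)
  finally show ?case using Suc by simp
qed simp

text \<open>The \<open>Suc k\<close> distinct points of the forward orbit each carry at least the
  mass of \<open>x\<close>, and the total mass is \<open>1\<close>.\<close>

lemma measure_singleton_le:
  assumes \<mu>: "\<mu> \<in> MX" and x: "x \<in> X"
    and inj: "\<And>i j. i < j \<Longrightarrow> j \<le> k \<Longrightarrow> (T ^^ i) x \<noteq> (T ^^ j) x"
  shows "measure \<mu> {x} \<le> 1 / real (Suc k)"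
proof -
  interpret prob_space \<mu> by (rule MX_D(1)[OF \<mu>])
  have "inj_on (\<lambda>i. (T ^^ i) x) {..k}"
    by (rule linorder_inj_onI) (use inj in auto)
  have "real (Suc k) * measure \<mu> {x} = (\<Sum>i\<le>k. measure \<mu> {x})" by simp
  also have "\<dots> \<le> (\<Sum>i\<le>k. measure \<mu> {(T ^^ i) x})"
    by (intro sum_mono measure_singleton_le_image[OF \<mu> x])
  also have "\<dots> = (\<Sum>y\<in>(\<lambda>i. (T ^^ i) x) ` {..k}. measure \<mu> {y})"
    using \<open>inj_on _ _\<close> by (simp add: sum.reindex)
  also have "\<dots> = measure \<mu> ((\<lambda>i. (T ^^ i) x) ` {..k})"
    by (rule finite_measure_eq_sum_singleton[symmetric])
      (use MX_singleton[OF \<mu> funpow_into[OF x]] in auto)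
  also have "\<dots> \<le> 1" by simp
  finally show ?thesis by (simp add: field_simps)
qed

text \<open>One tracing radius serves all three estimates: below the modulus of continuity of
  \<open>F\<close> it transfers the averages of the cycle to almost every point, and below half the
  least return distance of \<open>a\<close> it prevents the orbit of an atom from closing up within
  \<open>k\<close> steps.\<close>

lemma approximating_measure:
  fixes F :: "('a \<Rightarrow> real) set"
  assumes trans: "transitive_system X T" and shadowing: "shadowing_property X T"
    and inf: "infinite X" and \<mu>: "\<mu> \<in> MX"
    and F: "finite F" "\<And>f. f \<in> F \<Longrightarrow> continuous_on X f" and \<epsilon>: "\<epsilon> > 0"
  shows "\<exists>\<nu> N. \<nu> \<in> MX \<and> N > 0 \<and>
    (\<forall>f\<in>F. \<bar>(\<integral>x. f x \<partial>\<nu>) - (\<integral>x. f x \<partial>\<mu>)\<bar> < \<epsilon>) \<and>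
    (\<forall>f\<in>F. \<exists>c. AE x in \<nu>. \<bar>bavg N f x - c\<bar> \<le> \<epsilon>) \<and>
    (\<forall>x\<in>X. measure \<nu> {x} \<le> 1 / real (Suc k))"
proof -
  obtain a where a: "a \<in> X" "\<And>P. 0 < P \<Longrightarrow> P \<le> k \<Longrightarrow> (T ^^ P) a \<noteq> a"
    using exists_point_without_small_period[OF trans inf, of k] by blast
  obtain \<eta> where \<eta>: "\<eta> > 0" "\<And>P. 0 < P \<Longrightarrow> P \<le> k \<Longrightarrow> \<eta> \<le> dist a ((T ^^ P) a)"
  proof -
    have "finite ((\<lambda>P. (T ^^ P) a) ` {..k})" by simp
    then obtain d where d: "d > 0" "\<forall>x\<in>(\<lambda>P. (T ^^ P) a) ` {..k}. x \<noteq> a \<longrightarrow> d \<le> dist a x"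
      using finite_set_avoid[of _ a] by blast
    have "d \<le> dist a ((T ^^ P) a)" if "0 < P" "P \<le> k" for P
      using bspec[OF d(2), of "(T ^^ P) a"] a(2)[OF that] that(2) by auto
    with d(1) that show thesis by blast
  qed
  have \<epsilon>2: "\<epsilon> / 2 > 0" using \<epsilon> by simp
  obtain \<delta>f where \<delta>f: "\<delta>f > 0"
    "\<And>f x y. f \<in> F \<Longrightarrow> x \<in> X \<Longrightarrow> y \<in> X \<Longrightarrow> dist x y < \<delta>f \<Longrightarrow> \<bar>f x - f y\<bar> < \<epsilon> / 2"
    using finite_family_modulus[OF F(1) compact_space F(2) \<epsilon>2] by auto
  \<comment> \<open>A third of \<open>\<eta>\<close> gives \<open>2 * e < \<eta>\<close> strictly,
    so no point is within \<open>e\<close> of both \<open>a\<close> and one of its first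
    \<open>k\<close> proper iterates.\<close>
  define e where "e = min (\<eta> / 3) (\<delta>f / 2)"
  have e: "e > 0" "2 * e < \<eta>" "e < \<delta>f" using \<eta>(1) \<delta>f(1) by (auto simp: e_def)
  obtain \<delta> where \<delta>: "\<delta> > 0"
    "\<forall>N z. N > 0 \<and> (\<forall>n. z (n + N) = z n) \<and> pseudo_orbit X T \<delta> z \<longrightarrow>
       (\<exists>\<nu>\<in>MX. AE x in \<nu>. \<exists>s. \<forall>i. dist ((T ^^ i) x) (z (s + i)) \<le> e)"
    using measure_traced_by_cycle[OF shadowing e(1)] by (elim exE conjE) (rule that)
  have "\<exists>N z. N > 0 \<and> (\<forall>n. z (n + N) = z n) \<and> pseudo_orbit X T \<delta> z \<and>
    (\<exists>j. \<forall>i\<le>k. z (j + i) = (T ^^ i) a) \<and>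
    (\<forall>f\<in>F. \<bar>(\<Sum>n<N. f (z n)) / real N - (\<integral>x. f x \<partial>\<mu>)\<bar> < \<epsilon> / 2)"
    by (rule cycle_near_measure[OF trans \<delta>(1) a(1) \<mu> F(1) _ \<epsilon>2]) (rule F(2))
  then obtain N z j0 where N: "N > 0" and z: "\<forall>n. z (n + N) = z n" "pseudo_orbit X T \<delta> z"
    "\<forall>i\<le>k. z (j0 + i) = (T ^^ i) a"
    "\<forall>f\<in>F. \<bar>(\<Sum>n<N. f (z n)) / real N - (\<integral>x. f x \<partial>\<mu>)\<bar> < \<epsilon> / 2"
    by (elim exE conjE) (rule that)
  from \<delta>(2) N z(1,2) have "\<exists>\<nu>\<in>MX. AE x in \<nu>. \<exists>s. \<forall>i. dist ((T ^^ i) x) (z (s + i)) \<le> e" by simp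
  then obtain \<nu> where \<nu>: "\<nu> \<in> MX" and traced: "AE x in \<nu>. \<exists>s. \<forall>i. dist ((T ^^ i) x) (z (s + i)) \<le> e"
    by (elim bexE) (rule that)
  interpret \<nu>: prob_space \<nu> by (rule MX_D(1)[OF \<nu>])
  have z_in: "z n \<in> X" for n using z(2) by (simp add: pseudo_orbit_def)
  define c where "c f = (\<Sum>n<N. f (z n)) / real N" for f :: "'a \<Rightarrow> real"
  have near: "AE x in \<nu>. \<bar>bavg N f x - c f\<bar> \<le> \<epsilon> / 2" if f: "f \<in> F" for f
    using traced AE_space
  proof eventually_elim
    fix x assume "\<exists>s. \<forall>i. dist ((T ^^ i) x) (z (s + i)) \<le> e" and "x \<in> space \<nu>"
    then obtain s where s: "\<And>i. dist ((T ^^ i) x) (z (s + i)) \<le> e" and x: "x \<in> X"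
      using MX_D(3)[OF \<nu>] by blast
    \<comment> \<open>A sum over a full period does not depend on the phase \<open>s\<close>, so all
      traced points are compared with the same constant.\<close>
    have "c f = (\<Sum>i<N. f (z (s + i))) / real N"
      unfolding c_def using sum_periodic_shift[of "\<lambda>n. f (z n)" N s] z(1) by simp
    then have "bavg N f x - c f = (\<Sum>i<N. f ((T ^^ i) x) - f (z (s + i))) / real N"
      by (simp add: bavg_def sum_subtractf diff_divide_distrib)
    moreover have "\<bar>\<Sum>i<N. f ((T ^^ i) x) - f (z (s + i))\<bar> \<le> (\<Sum>i<N. \<epsilon> / 2)"
    proof (rule order_trans[OF sum_abs sum_mono])
      fix i
      have "dist ((T ^^ i) x) (z (s + i)) < \<delta>f" using s[of i] e(3) by linarith
      then show "\<bar>f ((T ^^ i) x) - f (z (s + i))\<bar> \<le> \<epsilon> / 2"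
        by (rule less_imp_le[OF \<delta>f(2)[OF f funpow_into[OF x] z_in]])
    qed
    ultimately have "\<bar>bavg N f x - c f\<bar> = \<bar>\<Sum>i<N. f ((T ^^ i) x) - f (z (s + i))\<bar> / real N"
      "\<bar>\<Sum>i<N. f ((T ^^ i) x) - f (z (s + i))\<bar> \<le> \<epsilon> / 2 * real N"
      by (simp_all add: abs_divide mult.commute)
    then show "\<bar>bavg N f x - c f\<bar> \<le> \<epsilon> / 2"
      using N by (simp only: pos_divide_le_eq of_nat_0_less_iff)
  qed
  show ?thesis
  proof (rule exI[of _ \<nu>], rule exI[of _ N], intro conjI ballI \<nu> N)
    fix f assume f: "f \<in> F"
    show "\<exists>c. AE x in \<nu>. \<bar>bavg N f x - c\<bar> \<le> \<epsilon>"
      using near[OF f] \<epsilon> by (intro exI[of _ "c f"]) (auto elim!: eventually_mono)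
  next
    fix f assume f: "f \<in> F"
    have int_f: "integrable \<nu> f" by (rule integrable_continuous[OF MX_D(1,2)[OF \<nu>] F(2)[OF f]])
    have "(\<integral>x. bavg N f x \<partial>\<nu>) \<le> c f + \<epsilon> / 2"
      by (rule \<nu>.integral_le_const[OF integral_bavg(1)[OF \<nu> int_f N]])
        (use near[OF f] in eventually_elim, linarith)
    moreover have "(\<integral>x. bavg N f x \<partial>\<nu>) \<ge> c f - \<epsilon> / 2"
      by (rule \<nu>.integral_ge_const[OF integral_bavg(1)[OF \<nu> int_f N]])
        (use near[OF f] in eventually_elim, linarith)
    moreover have "\<bar>c f - (\<integral>x. f x \<partial>\<mu>)\<bar> < \<epsilon> / 2" using z(4) f by (simp add: c_def)
    ultimately show "\<bar>(\<integral>x. f x \<partial>\<nu>) - (\<integral>x. f x \<partial>\<mu>)\<bar> < \<epsilon>"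
      unfolding integral_bavg(2)[OF \<nu> int_f N] by linarith
  next
    fix x assume x: "x \<in> X"
    show "measure \<nu> {x} \<le> 1 / real (Suc k)"
    proof (cases "measure \<nu> {x} = 0")
      case False
      \<comment> \<open>A point of positive mass cannot lie in the exceptional null set, so an atom
        is itself traced.\<close>
      have "\<exists>s. \<forall>i. dist ((T ^^ i) x) (z (s + i)) \<le> e"
      proof (rule ccontr)
        assume no: "\<not> ?thesis"
        have "AE y in \<nu>. y \<notin> {x}"
          using traced by eventually_elim (use no in auto)
        then have "measure \<nu> {x} = 0"
          using MX_singleton[OF \<nu> x] by (simp add: AE_iff_measurable[OF _ refl] \<nu>.prob_eq_0)
        then show False using False by simp
      qed
      then obtain s where s: "\<And>i. dist ((T ^^ i) x) (z (s + i)) \<le> e" by blast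
      show ?thesis
      proof (rule measure_singleton_le[OF \<nu> x])
        fix i j assume ij: "i < j" "j \<le> k"
        show "(T ^^ i) x \<noteq> (T ^^ j) x"
        proof
          assume eq: "(T ^^ i) x = (T ^^ j) x"
          define P where "P = j - i"
          have P: "0 < P" "P \<le> k" "j = P + i" using ij by (auto simp: P_def)
          \<comment> \<open>A time at which the traced index \<open>s + m\<close> has the phase of
            \<open>j0\<close>, and late enough, \<open>i \<le> m\<close>, for the orbit to have
            become periodic with period \<open>P\<close>. Since
            \<open>s + i \<le> (s + i) * N\<close>, the subtraction is not truncated.\<close>
          define m where "m = j0 + (s + i) * N - s"
          have "s + i \<le> (s + i) * N" using N by simp
          then have m: "i \<le> m" "s + m = j0 + (s + i) * N" unfolding m_def by linarith+
          have zm: "z (s + (m + t)) = (T ^^ t) a" if "t \<le> k" for t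
          proof -
            have "s + (m + t) = (j0 + t) + (s + i) * N" using m(2) by linarith
            then have "(s + (m + t)) mod N = (j0 + t) mod N" by (simp only: mod_mult_self1)
            with z(1)[rule_format] have "z (s + (m + t)) = z (j0 + t)" by (rule periodic_cong)
            then show ?thesis using z(3) that by simp
          qed
          have "(T ^^ (m + P)) x = (T ^^ (m - i)) ((T ^^ j) x)"
            using m(1) P(3) by (simp flip: comp_apply[of "T ^^ _" "T ^^ _"] funpow_add)
          also have "\<dots> = (T ^^ m) x"
            unfolding eq[symmetric] using m(1) by (simp flip: comp_apply[of "T ^^ _" "T ^^ _"] funpow_add)
          finally have per: "(T ^^ (m + P)) x = (T ^^ m) x" .
          \<comment> \<open>By periodicity the same point is close to the cycle at the two times
            \<open>m\<close> and \<open>m + P\<close>, where the cycle shows \<open>a\<close> and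
            its \<open>P\<close>-th iterate.\<close>
          have "dist ((T ^^ m) x) a \<le> e" using s[of m] zm[of 0] by simp
          moreover have "dist ((T ^^ m) x) ((T ^^ P) a) \<le> e" using s[of "m + P"] zm[OF P(2)] per by simp
          ultimately have "dist a ((T ^^ P) a) \<le> 2 * e"
            using dist_triangle3[of a "(T ^^ P) a" "(T ^^ m) x"] by linarith
          then show False using \<eta>(2)[OF P(1,2)] e(2) by linarith
        qed
      qed
    qed simp
  qed
qed

end

section \<open>Category\<close>

lemma nowhere_dense_inI:
  assumes "closedin S A" "\<And>W. openin S W \<Longrightarrow> W \<noteq> {} \<Longrightarrow> \<not> W \<subseteq> A"
  shows "nowhere_dense_in S A"
  unfolding nowhere_dense_in_def closure_of_closedin[OF assms(1)]
  using closedin_subset[OF assms(1)] assms(2)[OF openin_interior_of] interior_of_subset[of S A] by blast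

lemma nowhere_dense_in_subset:
  assumes "nowhere_dense_in S A" "B \<subseteq> A"
  shows "nowhere_dense_in S B"
  using assms interior_of_mono[OF closure_of_mono[OF assms(2), of S], of S]
  unfolding nowhere_dense_in_def by blast

text \<open>\<open>first_category_in\<close> asks for an exact union, so a covering family is
  trimmed to \<open>A\<close>; trimming keeps its members nowhere dense.\<close>

lemma first_category_in_subset:
  assumes "countable \<N>" "\<And>N. N \<in> \<N> \<Longrightarrow> nowhere_dense_in S N" "A \<subseteq> \<Union>\<N>"
  shows "first_category_in S A"
  unfolding first_category_in_def
proof (intro exI[of _ "(\<lambda>N. N \<inter> A) ` \<N>"] conjI ballI)
  show "countable ((\<lambda>N. N \<inter> A) ` \<N>)" using assms(1) by simp
  show "A = \<Union>((\<lambda>N. N \<inter> A) ` \<N>)" using assms(3) by blast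
  fix N assume "N \<in> (\<lambda>N. N \<inter> A) ` \<N>"
  then obtain N' where "N' \<in> \<N>" "N = N' \<inter> A" by blast
  then show "nowhere_dense_in S N"
    using nowhere_dense_in_subset[OF assms(2)] by blast
qed

context compact_dynamics begin

section \<open>Variances of Birkhoff averages as a test for ergodicity\<close>

abbreviation WS :: "'a measure topology" where "WS \<equiv> weak_star_topology X T"

text \<open>For \<open>n > 0\<close> and an invariant measure, \<open>f\<close> and
  \<open>bavg n f\<close> have the same mean, so this is the variance of
  \<open>bavg n f\<close>.\<close>

definition bavg_variance :: "nat \<Rightarrow> ('a \<Rightarrow> real) \<Rightarrow> 'a measure \<Rightarrow> real" where
  "bavg_variance n f \<mu> = (\<integral>x. (bavg n f x)\<^sup>2 \<partial>\<mu>) - (\<integral>x. f x \<partial>\<mu>)\<^sup>2"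

lemma continuous_map_bavg_variance:
  assumes "continuous_on X f"
  shows "continuous_map WS euclideanreal (bavg_variance n f)"
  unfolding bavg_variance_def
  by (intro continuous_intros continuous_map_integral continuous_bavg assms)

text \<open>The variance is the least second moment about a constant, so any \<open>c\<close> may
  stand in for the mean.\<close>

lemma bavg_variance_le:
  assumes \<mu>: "\<mu> \<in> MX" and f: "continuous_on X f" and n: "n > 0"
    and c: "AE x in \<mu>. \<bar>bavg n f x - c\<bar> \<le> \<epsilon>"
  shows "bavg_variance n f \<mu> \<le> \<epsilon>\<^sup>2"
proof -
  interpret prob_space \<mu> by (rule MX_D(1)[OF \<mu>])
  note int = integrable_continuous[OF MX_D(1,2)[OF \<mu>]]
  have b: "integrable \<mu> (bavg n f)" "integrable \<mu> (\<lambda>x. (bavg n f x)\<^sup>2)"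
    "integrable \<mu> (\<lambda>x. (bavg n f x - c)\<^sup>2)"
    by (intro int continuous_intros continuous_bavg[OF f])+
  have avg: "(\<integral>x. bavg n f x \<partial>\<mu>) = (\<integral>x. f x \<partial>\<mu>)"
    by (rule integral_bavg(2)[OF \<mu> int[OF f] n])
  have "(\<integral>x. (bavg n f x - c)\<^sup>2 \<partial>\<mu>) = (\<integral>x. (bavg n f x)\<^sup>2 - 2 * c * bavg n f x + c\<^sup>2 \<partial>\<mu>)"
    by (simp add: power2_diff algebra_simps)
  also have "\<dots> = (\<integral>x. (bavg n f x)\<^sup>2 \<partial>\<mu>) - 2 * c * (\<integral>x. f x \<partial>\<mu>) + c\<^sup>2"
    using b(1,2) by (simp add: avg prob_space)
  also have "\<dots> = bavg_variance n f \<mu> + ((\<integral>x. f x \<partial>\<mu>) - c)\<^sup>2"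
    by (simp add: bavg_variance_def power2_diff algebra_simps)
  finally have "bavg_variance n f \<mu> \<le> (\<integral>x. (bavg n f x - c)\<^sup>2 \<partial>\<mu>)" by simp
  also have "\<dots> \<le> \<epsilon>\<^sup>2"
    by (rule integral_le_const[OF b(3)])
      (use c in eventually_elim, metis abs_ge_zero power2_abs power_mono)
  finally show ?thesis .
qed

text \<open>Closedness comes from an intersection over all \<open>n\<close>. Membership requires a
  large variance for every \<open>n\<close>, so a single \<open>N\<close> with small variance
  already expels \<open>\<nu>\<close>.\<close>

lemma nowhere_dense_variance:
  assumes trans: "transitive_system X T" and shadowing: "shadowing_property X T"
    and inf: "infinite X" and f: "continuous_on X f"
  shows "nowhere_dense_in WS {\<mu> \<in> MX. \<forall>n>0. 1 / real (Suc m) \<le> bavg_variance n f \<mu>}"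
proof (rule nowhere_dense_inI)
  have "closedin WS {\<mu> \<in> topspace WS. bavg_variance n f \<mu> \<in> {1 / real (Suc m)..}}" for n
    by (rule closedin_continuous_map_preimage[OF continuous_map_bavg_variance[OF f]]) simp
  then have "closedin WS (\<Inter>n\<in>{0<..}. {\<mu> \<in> topspace WS. bavg_variance n f \<mu> \<in> {1 / real (Suc m)..}})"
    by (intro closedin_Inter) auto
  moreover have "(\<Inter>n\<in>{0<..}. {\<mu> \<in> topspace WS. bavg_variance n f \<mu> \<in> {1 / real (Suc m)..}}) =
      {\<mu> \<in> MX. \<forall>n>0. 1 / real (Suc m) \<le> bavg_variance n f \<mu>}"
    by auto
  ultimately show "closedin WS {\<mu> \<in> MX. \<forall>n>0. 1 / real (Suc m) \<le> bavg_variance n f \<mu>}" by simp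
  fix W assume W: "openin WS W" "W \<noteq> {}"
  then obtain \<mu> where \<mu>: "\<mu> \<in> W" by blast
  then have \<mu>M: "\<mu> \<in> MX" using openin_subset[OF W(1)] by auto
  obtain F :: "('a \<Rightarrow> real) set" and \<epsilon> where F: "finite F" "\<And>f. f \<in> F \<Longrightarrow> continuous_on X f" "\<epsilon> > 0"
    "\<And>\<nu>. \<nu> \<in> MX \<Longrightarrow> (\<And>f. f \<in> F \<Longrightarrow> \<bar>(\<integral>x. f x \<partial>\<nu>) - (\<integral>x. f x \<partial>\<mu>)\<bar> < \<epsilon>) \<Longrightarrow> \<nu> \<in> W"
    using weak_star_neighbourhood[OF W(1) \<mu>] by blast
  \<comment> \<open>The first bound keeps \<open>\<nu>\<close> in \<open>W\<close>. The second gives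
    \<open>e \<le> 1\<close>, hence \<open>e\<^sup>2 \<le> e\<close>, which lies below
    \<open>1 / Suc m\<close>. Adding \<open>f\<close> to \<open>F\<close> makes its average nearly
    constant as well.\<close>
  define e where "e = min \<epsilon> (1 / (2 * real (Suc m)))"
  have e: "e > 0" "e \<le> \<epsilon>" "e \<le> 1 / (2 * real (Suc m))" using F(3) by (auto simp: e_def)
  have fin: "finite (insert f F)" using F(1) by simp
  have cont: "\<And>g. g \<in> insert f F \<Longrightarrow> continuous_on X g" using f F(2) by auto
  have "\<exists>\<nu> N. \<nu> \<in> MX \<and> N > 0 \<and>
    (\<forall>g\<in>insert f F. \<bar>(\<integral>x. g x \<partial>\<nu>) - (\<integral>x. g x \<partial>\<mu>)\<bar> < e) \<and>
    (\<forall>g\<in>insert f F. \<exists>c. AE x in \<nu>. \<bar>bavg N g x - c\<bar> \<le> e) \<and>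
    (\<forall>x\<in>X. measure \<nu> {x} \<le> 1 / real (Suc 0))"
    by (rule approximating_measure[OF trans shadowing inf \<mu>M fin _ e(1)]) (rule cont)
  then obtain \<nu> N where \<nu>: "\<nu> \<in> MX" "N > 0"
    "\<forall>g\<in>insert f F. \<bar>(\<integral>x. g x \<partial>\<nu>) - (\<integral>x. g x \<partial>\<mu>)\<bar> < e"
    "\<forall>g\<in>insert f F. \<exists>c. AE x in \<nu>. \<bar>bavg N g x - c\<bar> \<le> e"
    by (elim exE conjE) (rule that)
  have "\<nu> \<in> W"
  proof (rule F(4)[OF \<nu>(1)])
    fix g assume "g \<in> F"
    then show "\<bar>(\<integral>x. g x \<partial>\<nu>) - (\<integral>x. g x \<partial>\<mu>)\<bar> < \<epsilon>"
      using bspec[OF \<nu>(3), of g] e(2) by simp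
  qed
  moreover have "bavg_variance N f \<nu> < 1 / real (Suc m)"
  proof -
    obtain c where "AE x in \<nu>. \<bar>bavg N f x - c\<bar> \<le> e" using \<nu>(4) by blast
    then have "bavg_variance N f \<nu> \<le> e\<^sup>2" by (rule bavg_variance_le[OF \<nu>(1) f \<nu>(2)])
    also have "e\<^sup>2 \<le> e * 1"
      unfolding power2_eq_square
    proof (rule mult_left_mono)
      have "1 / (2 * real (Suc m)) \<le> 1" by simp
      with e(3) show "e \<le> 1" by linarith
    qed (use e(1) in simp)
    also have "\<dots> \<le> 1 / (2 * real (Suc m))" using e(3) by simp
    also have "\<dots> < 1 / real (Suc m)" by (simp add: field_simps)
    finally show ?thesis .
  qed
  then have "\<nu> \<notin> {\<mu> \<in> MX. \<forall>n>0. 1 / real (Suc m) \<le> bavg_variance n f \<mu>}"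
    using \<nu>(2) unfolding not_le[symmetric] by blast
  ultimately show "\<not> W \<subseteq> {\<mu> \<in> MX. \<forall>n>0. 1 / real (Suc m) \<le> bavg_variance n f \<mu>}"
    by blast
qed

text \<open>Averaging fixes the invariant indicator and does not increase its
  \<open>L\<^sup>1\<close> distance from \<open>g\<close>, so the bound is uniform in
  \<open>n\<close>. Squaring at most doubles distances in the unit interval; this happens once in
  the second moment and once in the squared mean, whence \<open>4 * \<eta>\<close>.\<close>

lemma invariant_set_variance:
  assumes \<mu>: "\<mu> \<in> MX" and A: "A \<in> sets \<mu>" "T -` A \<inter> X = A"
    and g: "continuous_on X g" "\<And>x. x \<in> X \<Longrightarrow> g x \<in> {0..1}"
    and \<eta>: "(\<integral>x. \<bar>g x - indicator A x\<bar> \<partial>\<mu>) \<le> \<eta>" and n: "n > 0"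
  shows "measure \<mu> A - (measure \<mu> A)\<^sup>2 - 4 * \<eta> \<le> bavg_variance n g \<mu>"
proof -
  interpret prob_space \<mu> by (rule MX_D(1)[OF \<mu>])
  note int = integrable_continuous[OF MX_D(1,2)[OF \<mu>]]
  note sp = MX_D(3)[OF \<mu>]
  define p where "p = measure \<mu> A"
  define h where "h x = \<bar>g x - indicator A x\<bar>" for x
  have AX: "A \<inter> X = A" using sets.sets_into_space[OF A(1)] sp by auto
  have int_A: "integrable \<mu> (\<lambda>x. indicator A x :: real)" "(\<integral>x. indicator A x \<partial>\<mu>) = p"
    using A(1) AX sp by (auto intro: integrable_real_indicator simp: p_def emeasure_eq_measure)
  have int_h: "integrable \<mu> h"
    unfolding h_def by (intro integrable_abs Bochner_Integration.integrable_diff int g(1) int_A)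
  have inv: "indicator A ((T ^^ i) x) = (indicator A x :: real)" if "x \<in> X" for x i
  proof (induction i)
    case (Suc i)
    have "(T ^^ i) x \<in> X" using funpow_into[OF that] .
    then have "T ((T ^^ i) x) \<in> A \<longleftrightarrow> (T ^^ i) x \<in> A" using A(2) by blast
    then show ?case using Suc by (simp add: indicator_def)
  qed simp
  have b01: "bavg n g x \<in> {0..1}" if x: "x \<in> X" for x
  proof -
    have "0 \<le> (\<Sum>i<n. g ((T ^^ i) x))" using g(2)[OF funpow_into[OF x]] by (intro sum_nonneg) auto
    moreover have "(\<Sum>i<n. g ((T ^^ i) x)) \<le> (\<Sum>i<n. 1)"
      using g(2)[OF funpow_into[OF x]] by (intro sum_mono) auto
    ultimately show ?thesis using n by (simp add: bavg_def)
  qed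
  have pointwise: "indicator A x - (bavg n g x)\<^sup>2 \<le> 2 * bavg n h x" if x: "x \<in> X" for x
  proof -
    let ?a = "indicator A x :: real" and ?b = "bavg n g x"
    have "(\<Sum>i<n. g ((T ^^ i) x) - indicator A ((T ^^ i) x)) = (\<Sum>i<n. g ((T ^^ i) x)) - real n * ?a"
      by (simp add: sum_subtractf inv[OF x])
    then have "?b - ?a = (\<Sum>i<n. g ((T ^^ i) x) - indicator A ((T ^^ i) x)) / real n"
      using n by (simp add: bavg_def field_simps)
    also have "\<bar>\<dots>\<bar> \<le> bavg n h x"
      unfolding bavg_def h_def abs_divide abs_of_nat by (intro divide_right_mono sum_abs) simp
    finally have "\<bar>?b - ?a\<bar> \<le> bavg n h x" .
    then have le: "\<bar>?b - ?a\<bar> * 2 \<le> 2 * bavg n h x" by simp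
    \<comment> \<open>An indicator equals its square, which turns the left side into a difference of
      squares.\<close>
    have "?a - ?b\<^sup>2 = (?a - ?b) * (?a + ?b)"
      by (simp add: power2_eq_square algebra_simps indicator_def)
    also have "\<dots> \<le> \<bar>?b - ?a\<bar> * 2"
    proof (rule mult_mono)
      show "?a + ?b \<le> 2" "0 \<le> ?a + ?b" using b01[OF x] by (auto simp: indicator_def)
    qed linarith+
    also note le
    finally show ?thesis .
  qed
  have int_b: "integrable \<mu> (\<lambda>x. (bavg n g x)\<^sup>2)"
    by (intro int continuous_intros continuous_bavg g(1))
  have "p - (\<integral>x. (bavg n g x)\<^sup>2 \<partial>\<mu>) = (\<integral>x. indicator A x - (bavg n g x)\<^sup>2 \<partial>\<mu>)"
    using int_A int_b by simp
  also have "\<dots> \<le> (\<integral>x. 2 * bavg n h x \<partial>\<mu>)"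
    using int_A int_b integral_bavg(1)[OF \<mu> int_h n] pointwise sp
    by (intro integral_mono) simp_all
  also have "\<dots> = 2 * (\<integral>x. h x \<partial>\<mu>)" using integral_bavg(2)[OF \<mu> int_h n] by simp
  finally have 1: "p - (\<integral>x. (bavg n g x)\<^sup>2 \<partial>\<mu>) \<le> 2 * \<eta>" using \<eta> by (simp add: h_def)
  have "\<bar>(\<integral>x. g x \<partial>\<mu>) - p\<bar> = \<bar>\<integral>x. g x - indicator A x \<partial>\<mu>\<bar>"
    using int[OF g(1)] int_A by simp
  also have "\<dots> \<le> (\<integral>x. h x \<partial>\<mu>)" unfolding h_def by (rule integral_abs_bound)
  finally have gp: "\<bar>(\<integral>x. g x \<partial>\<mu>) - p\<bar> \<le> \<eta>" using \<eta> by (simp add: h_def)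
  have g1: "0 \<le> (\<integral>x. g x \<partial>\<mu>)" "(\<integral>x. g x \<partial>\<mu>) \<le> 1"
    using integral_ge_const[OF int[OF g(1)], of 0] integral_le_const[OF int[OF g(1)], of 1] g(2) sp
    by (auto intro: AE_I2)
  have p1: "0 \<le> p" "p \<le> 1" by (simp_all add: p_def)
  have "(\<integral>x. g x \<partial>\<mu>)\<^sup>2 - p\<^sup>2 = ((\<integral>x. g x \<partial>\<mu>) - p) * ((\<integral>x. g x \<partial>\<mu>) + p)"
    by (simp add: power2_eq_square algebra_simps)
  also have "\<dots> \<le> \<eta> * 2" using gp g1 p1 by (intro mult_mono) auto
  finally show ?thesis using 1 by (simp add: bavg_variance_def p_def)
qed

lemma nonergodic_variance:
  assumes \<mu>: "\<mu> \<in> MX" "\<mu> \<notin> ergodic_measures X T"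
    and D: "\<And>g. g \<in> D \<Longrightarrow> continuous_on UNIV g" "\<And>g x. g \<in> D \<Longrightarrow> g x \<in> {0..1::real}"
      "\<And>f \<epsilon>. continuous_on X f \<Longrightarrow> (\<And>x. x \<in> X \<Longrightarrow> f x \<in> {0..1}) \<Longrightarrow> \<epsilon> > 0 \<Longrightarrow>
       \<exists>g\<in>D. \<forall>x\<in>X. \<bar>g x - f x\<bar> < \<epsilon>"
  shows "\<exists>g\<in>D. \<exists>m. \<forall>n>0. 1 / real (Suc m) \<le> bavg_variance n g \<mu>"
proof -
  interpret prob_space \<mu> by (rule MX_D(1)[OF \<mu>(1)])
  note sp = MX_D(3)[OF \<mu>(1)]
  obtain A where A: "A \<in> sets \<mu>" "T -` A \<inter> X = A" "emeasure \<mu> A \<noteq> 0" "emeasure \<mu> A \<noteq> 1"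
    using \<mu> unfolding ergodic_measures_def by blast
  define p where "p = measure \<mu> A"
  have "p \<noteq> 0" "p \<noteq> 1" using A(3,4) by (auto simp: p_def emeasure_eq_measure)
  moreover have "0 \<le> p" "p \<le> 1" by (simp_all add: p_def)
  ultimately have "0 < p * (1 - p)" by simp
  then have q: "0 < p - p\<^sup>2" by (simp add: power2_eq_square algebra_simps)
  \<comment> \<open>\<open>4 * \<eta>\<close> is half of the gap, so the other half remains as lower
    bound. Passing to a continuous \<open>f\<close> and then to a member of \<open>D\<close> costs
    \<open>\<eta> / 2\<close> each.\<close>
  define \<eta> where "\<eta> = (p - p\<^sup>2) / 8"
  have \<eta>: "\<eta> / 2 > 0" using q by (simp add: \<eta>_def)
  have "A \<in> (\<inter>) X ` sets borel"
    using A(1) unfolding MX_D(2)[OF \<mu>(1)] sets_restrict_space .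
  then obtain B where B: "B \<in> sets borel" "A = X \<inter> B" by (rule imageE)
  obtain f where f: "continuous_on UNIV f" "\<forall>x. f x \<in> {0..1::real}"
    "(\<integral>x. \<bar>f x - indicator B x\<bar> \<partial>\<mu>) < \<eta> / 2"
    using indicator_approx_continuous[OF MX_D(1,2)[OF \<mu>(1)] B(1) \<eta>] by blast
  have fX: "continuous_on X f" by (rule continuous_on_subset[OF f(1)]) simp
  obtain g where g: "g \<in> D" "\<forall>x\<in>X. \<bar>g x - f x\<bar> < \<eta> / 2"
    using D(3)[OF fX _ \<eta>] f(2) by blast
  have gX: "continuous_on X g" by (rule continuous_on_subset[OF D(1)[OF g(1)]]) simp
  note int = integrable_continuous[OF MX_D(1,2)[OF \<mu>(1)]]
  have int_A: "integrable \<mu> (\<lambda>x. indicator A x :: real)"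
    using A(1) by (auto intro: integrable_real_indicator simp: emeasure_eq_measure)
  have "(\<integral>x. \<bar>g x - indicator A x\<bar> \<partial>\<mu>) \<le> (\<integral>x. \<bar>f x - indicator A x\<bar> + \<eta> / 2 \<partial>\<mu>)"
  proof (rule integral_mono)
    show "integrable \<mu> (\<lambda>x. \<bar>g x - indicator A x\<bar>)"
      by (intro integrable_abs Bochner_Integration.integrable_diff int[OF gX] int_A)
    show "integrable \<mu> (\<lambda>x. \<bar>f x - indicator A x\<bar> + \<eta> / 2)"
      by (intro Bochner_Integration.integrable_add integrable_abs Bochner_Integration.integrable_diff int[OF fX] int_A) simp
    fix x assume "x \<in> space \<mu>"
    then have "\<bar>g x - f x\<bar> < \<eta> / 2" using g(2) sp by simp
    then show "\<bar>g x - indicator A x\<bar> \<le> \<bar>f x - indicator A x\<bar> + \<eta> / 2" by linarith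
  qed
  also have "\<dots> = (\<integral>x. \<bar>f x - indicator A x\<bar> \<partial>\<mu>) + \<eta> / 2"
    using int[OF fX] int_A by (simp add: prob_space)
  also have "(\<integral>x. \<bar>f x - indicator A x\<bar> \<partial>\<mu>) = (\<integral>x. \<bar>f x - indicator B x\<bar> \<partial>\<mu>)"
    by (rule Bochner_Integration.integral_cong[OF refl]) (auto simp: B(2) sp indicator_def)
  finally have ge: "(\<integral>x. \<bar>g x - indicator A x\<bar> \<partial>\<mu>) \<le> \<eta>" using f(3) by simp
  obtain m where m: "1 / real (Suc m) < (p - p\<^sup>2) / 2"
    using reals_Archimedean[of "(p - p\<^sup>2) / 2"] q by (auto simp: inverse_eq_divide)
  have "1 / real (Suc m) \<le> bavg_variance n g \<mu>" if "n > 0" for n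
  proof -
    have "1 / real (Suc m) \<le> (p - p\<^sup>2) / 2" using m by (rule less_imp_le)
    also have "\<dots> = p - p\<^sup>2 - 4 * \<eta>" by (simp add: \<eta>_def field_simps)
    also have "\<dots> \<le> bavg_variance n g \<mu>"
      unfolding p_def using invariant_set_variance[OF \<mu>(1) A(1,2) gX D(2)[OF g(1)] ge that] .
    finally show ?thesis .
  qed
  with g(1) show ?thesis by blast
qed

text \<open>By the lemmas below, these are the invariant measures all of whose atoms have mass less
  than \<open>1 / Suc k\<close>. The mass of a point is not weak* continuous in the measure, so the
  condition is expressed through integrals over a finite cover by continuous functions.\<close>

definition small_atoms :: "nat \<Rightarrow> 'a measure set" where
  "small_atoms k = {\<mu> \<in> MX. \<exists>G. finite G \<and> (\<forall>g\<in>G. continuous_on X g \<and> (\<forall>x\<in>X. 0 \<le> g x)) \<and>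
     (\<forall>x\<in>X. \<exists>g\<in>G. 1 \<le> g x) \<and> (\<forall>g\<in>G. (\<integral>x. g x \<partial>\<mu>) < 1 / real (Suc k))}"

text \<open>The cover that works for \<open>\<mu>\<close> works for every measure whose integrals of
  these finitely many functions stay below the bound.\<close>

lemma openin_small_atoms: "openin WS (small_atoms k)"
proof (subst openin_subopen, intro ballI)
  fix \<mu> assume "\<mu> \<in> small_atoms k"
  then obtain G :: "('a \<Rightarrow> real) set" where \<mu>: "\<mu> \<in> MX" and G: "finite G"
    "\<forall>g\<in>G. continuous_on X g \<and> (\<forall>x\<in>X. 0 \<le> g x)" "\<forall>x\<in>X. \<exists>g\<in>G. 1 \<le> g x"
    "\<forall>g\<in>G. (\<integral>x. g x \<partial>\<mu>) < 1 / real (Suc k)"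
    unfolding small_atoms_def by auto
  define W where "W = {\<nu> \<in> MX. \<forall>g\<in>G. (\<integral>x. g x \<partial>\<nu>) < 1 / real (Suc k)}"
  have "openin WS {\<nu> \<in> topspace WS. (\<integral>x. g x \<partial>\<nu>) \<in> {..<1 / real (Suc k)}}" if "g \<in> G" for g
    by (rule openin_continuous_map_preimage[OF continuous_map_integral]) (use G(2) that in auto)
  then have "openin WS (topspace WS \<inter> (\<Inter>g\<in>G. {\<nu> \<in> topspace WS. (\<integral>x. g x \<partial>\<nu>) \<in> {..<1 / real (Suc k)}}))"
    using G(1) openin_topspace[of WS] by (intro openin_Int_Inter) auto
  moreover have "topspace WS \<inter> (\<Inter>g\<in>G. {\<nu> \<in> topspace WS. (\<integral>x. g x \<partial>\<nu>) \<in> {..<1 / real (Suc k)}}) = W"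
    unfolding W_def by auto
  ultimately have "openin WS W" by simp
  moreover have "\<mu> \<in> W" using \<mu> G(4) by (simp add: W_def)
  moreover have "W \<subseteq> small_atoms k"
    unfolding W_def small_atoms_def using G(1-3) by blast
  ultimately show "\<exists>W. openin WS W \<and> \<mu> \<in> W \<and> W \<subseteq> small_atoms k" by blast
qed

text \<open>Integrals of ever narrower bumps at \<open>x\<close> tend to the mass of
  \<open>x\<close>, so some bump is already below the bound; compactness reduces all these bumps to
  finitely many.\<close>

lemma small_atomsI:
  assumes \<mu>: "\<mu> \<in> MX" and atoms: "\<And>x. x \<in> X \<Longrightarrow> measure \<mu> {x} < 1 / real (Suc k)"
  shows "\<mu> \<in> small_atoms k"
proof -
  interpret prob_space \<mu> by (rule MX_D(1)[OF \<mu>])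
  \<comment> \<open>Equal to \<open>1\<close> up to distance \<open>1 / n\<close> and to
    \<open>0\<close> from distance \<open>2 / n\<close> on: the plateau lets balls of radius
    \<open>1 / n\<close> form the cover. Later uses take \<open>Suc n\<close>, since for
    \<open>n = 0\<close> the function is constantly \<open>1\<close>.\<close>
  define g where "g x n y = min 1 (max 0 (2 - real n * dist x y))" for x :: 'a and n y
  have cont: "continuous_on S (g x n)" for S x n unfolding g_def by (intro continuous_intros)
  have g01: "g x n y \<in> {0..1}" for x n y unfolding g_def by auto
  have "\<exists>n. (\<integral>y. g x (Suc n) y \<partial>\<mu>) < 1 / real (Suc k)" if x: "x \<in> X" for x
  proof -
    have lim: "(\<lambda>n. g x (Suc n) y) \<longlonglongrightarrow> indicator {x} y" for y
    proof (cases "y = x")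
      case False
      then have pos: "dist x y > 0" by simp
      obtain m where m: "2 / dist x y < real m" using reals_Archimedean2 by blast
      have "g x (Suc n) y = 0" if "n \<ge> m" for n
      proof -
        have "2 < real m * dist x y" using m pos by (simp add: field_simps)
        also have "\<dots> \<le> real (Suc n) * dist x y" using that pos by (intro mult_right_mono) auto
        finally show ?thesis by (simp add: g_def)
      qed
      then have "eventually (\<lambda>n. g x (Suc n) y = 0) sequentially"
        using eventually_sequentially by blast
      then show ?thesis using False by (simp add: tendsto_eventually)
    qed (simp add: g_def)
    have "(\<lambda>n. \<integral>y. g x (Suc n) y \<partial>\<mu>) \<longlonglongrightarrow> (\<integral>y. indicator {x} y \<partial>\<mu>)"
    proof (rule integral_dominated_convergence[where w = "\<lambda>_. 1"])
      show "AE y in \<mu>. norm (g x (Suc n) y) \<le> 1" for n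
        using g01[of x "Suc n"] by (intro AE_I2) auto
      show "g x (Suc n) \<in> borel_measurable \<mu>" for n
        by (rule measurable_continuous[OF MX_D(2)[OF \<mu>] cont])
    qed (use lim MX_singleton[OF \<mu> x] in simp_all)
    also have "(\<integral>y. indicator {x} y \<partial>\<mu>) = measure \<mu> {x}"
      using x MX_D(3)[OF \<mu>] by (simp add: Int_absorb2)
    finally have "eventually (\<lambda>n. (\<integral>y. g x (Suc n) y \<partial>\<mu>) < 1 / real (Suc k)) sequentially"
      using atoms[OF x] by (rule order_tendstoD)
    then show ?thesis unfolding eventually_sequentially by blast
  qed
  then obtain N where N: "\<And>x. x \<in> X \<Longrightarrow> (\<integral>y. g x (Suc (N x)) y \<partial>\<mu>) < 1 / real (Suc k)" by metis
  have "X \<subseteq> (\<Union>x\<in>X. ball x (1 / real (Suc (N x))))" by auto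
  then obtain S where S: "S \<subseteq> X" "finite S" "X \<subseteq> (\<Union>x\<in>S. ball x (1 / real (Suc (N x))))"
    using compactE_image[OF compact_space, of X "\<lambda>x. ball x (1 / real (Suc (N x)))"] by auto
  let ?G = "(\<lambda>x. g x (Suc (N x))) ` S"
  have "\<exists>h\<in>?G. 1 \<le> h y" if y: "y \<in> X" for y
  proof -
    obtain x where x: "x \<in> S" "dist x y < 1 / real (Suc (N x))" using S(3) y by (auto simp del: of_nat_Suc)
    then have "real (Suc (N x)) * dist x y \<le> 1" by (simp add: field_simps)
    then have "1 \<le> g x (Suc (N x)) y" unfolding g_def by simp
    with x(1) show ?thesis by blast
  qed
  moreover have "\<forall>h\<in>?G. continuous_on X h \<and> (\<forall>x\<in>X. 0 \<le> h x)" using cont g01 by auto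
  moreover have "\<forall>h\<in>?G. (\<integral>y. h y \<partial>\<mu>) < 1 / real (Suc k)" using N S(1) by blast
  ultimately show ?thesis
    unfolding small_atoms_def using \<mu> S(2) by (intro CollectI conjI exI[of _ ?G]) auto
qed

text \<open>Some member of the cover dominates the indicator of \<open>{x}\<close>, and its integral
  is below the bound.\<close>

lemma measure_less_of_small_atoms:
  assumes "\<mu> \<in> small_atoms k" "x \<in> X"
  shows "measure \<mu> {x} < 1 / real (Suc k)"
proof -
  obtain G :: "('a \<Rightarrow> real) set" where \<mu>: "\<mu> \<in> MX" and G:
    "\<forall>g\<in>G. continuous_on X g \<and> (\<forall>x\<in>X. 0 \<le> g x)" "\<forall>x\<in>X. \<exists>g\<in>G. 1 \<le> g x"
    "\<forall>g\<in>G. (\<integral>x. g x \<partial>\<mu>) < 1 / real (Suc k)"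
    using assms(1) unfolding small_atoms_def by auto
  interpret prob_space \<mu> by (rule MX_D(1)[OF \<mu>])
  obtain g where g: "g \<in> G" "1 \<le> g x" using G(2) assms(2) by blast
  have s: "{x} \<in> sets \<mu>" by (rule MX_singleton[OF \<mu> assms(2)])
  have "measure \<mu> {x} = (\<integral>y. indicator {x} y \<partial>\<mu>)"
    using assms(2) MX_D(3)[OF \<mu>] by (simp add: Int_absorb2)
  also have "\<dots> \<le> (\<integral>y. g y \<partial>\<mu>)"
  proof (rule integral_mono)
    show "integrable \<mu> (\<lambda>y. indicator {x} y :: real)"
      using s by (auto intro: integrable_real_indicator simp: emeasure_eq_measure)
    show "integrable \<mu> g" by (rule integrable_continuous[OF MX_D(1,2)[OF \<mu>]]) (use G(1) g in blast)
    show "indicator {x} y \<le> g y" if "y \<in> space \<mu>" for y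
      using G(1) g that MX_D(3)[OF \<mu>] by (auto simp: indicator_def)
  qed
  also have "\<dots> < 1 / real (Suc k)" using G(3) g(1) by blast
  finally show ?thesis .
qed

lemma nowhere_dense_large_atoms:
  assumes trans: "transitive_system X T" and shadowing: "shadowing_property X T"
    and inf: "infinite X"
  shows "nowhere_dense_in WS (MX - small_atoms k)"
proof (rule nowhere_dense_inI)
  show "closedin WS (MX - small_atoms k)"
    using openin_closedin_eq[of WS] closedin_diff[OF closedin_topspace openin_small_atoms] by simp
  fix W assume W: "openin WS W" "W \<noteq> {}"
  then obtain \<mu> where \<mu>: "\<mu> \<in> W" by blast
  then have \<mu>M: "\<mu> \<in> MX" using openin_subset[OF W(1)] by auto
  obtain F :: "('a \<Rightarrow> real) set" and \<epsilon> where F: "finite F" "\<And>f. f \<in> F \<Longrightarrow> continuous_on X f" "\<epsilon> > 0"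
    "\<And>\<nu>. \<nu> \<in> MX \<Longrightarrow> (\<And>f. f \<in> F \<Longrightarrow> \<bar>(\<integral>x. f x \<partial>\<nu>) - (\<integral>x. f x \<partial>\<mu>)\<bar> < \<epsilon>) \<Longrightarrow> \<nu> \<in> W"
    using weak_star_neighbourhood[OF W(1) \<mu>] by blast
  \<comment> \<open>The bound on atoms is requested for \<open>Suc k\<close>, because
    \<open>approximating_measure\<close> gives a weak inequality and \<open>small_atoms k\<close>
    needs a strict one.\<close>
  have "\<exists>\<nu> N. \<nu> \<in> MX \<and> N > 0 \<and>
    (\<forall>g\<in>F. \<bar>(\<integral>x. g x \<partial>\<nu>) - (\<integral>x. g x \<partial>\<mu>)\<bar> < \<epsilon>) \<and>
    (\<forall>g\<in>F. \<exists>c. AE x in \<nu>. \<bar>bavg N g x - c\<bar> \<le> \<epsilon>) \<and>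
    (\<forall>x\<in>X. measure \<nu> {x} \<le> 1 / real (Suc (Suc k)))"
    by (rule approximating_measure[OF trans shadowing inf \<mu>M F(1) _ F(3)]) (rule F(2))
  then obtain \<nu> where \<nu>: "\<nu> \<in> MX" "\<forall>g\<in>F. \<bar>(\<integral>x. g x \<partial>\<nu>) - (\<integral>x. g x \<partial>\<mu>)\<bar> < \<epsilon>"
    "\<forall>x\<in>X. measure \<nu> {x} \<le> 1 / real (Suc (Suc k))"
    by (elim exE conjE) (rule that)
  have "\<nu> \<in> W" by (rule F(4)[OF \<nu>(1)]) (use \<nu>(2) in simp)
  moreover have "\<nu> \<in> small_atoms k"
  proof (rule small_atomsI[OF \<nu>(1)])
    fix x assume "x \<in> X"
    then have "measure \<nu> {x} \<le> 1 / real (Suc (Suc k))" using \<nu>(3) by blast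
    also have "\<dots> < 1 / real (Suc k)" by (simp add: field_simps)
    finally show "measure \<nu> {x} < 1 / real (Suc k)" .
  qed
  ultimately show "\<not> W \<subseteq> MX - small_atoms k" by blast
qed

text \<open>A non-ergodic measure is caught by some pair \<open>(g, m)\<close> with \<open>g\<close>
  in the countable family \<open>D\<close>, and a measure with an atom by some \<open>k\<close>; two
  countable families of nowhere dense sets therefore cover the complement.\<close>

lemma residual_nonatomic_ergodic:
  assumes trans: "transitive_system X T" and shadowing: "shadowing_property X T"
    and inf: "infinite X"
  shows "residual_in WS {\<mu> \<in> ergodic_measures X T. nonatomic_on X \<mu>}"
proof -
  obtain D :: "('a \<Rightarrow> real) set" where D: "countable D"
    "\<And>g. g \<in> D \<Longrightarrow> continuous_on UNIV g" "\<And>g x. g \<in> D \<Longrightarrow> g x \<in> {0..1}"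
    "\<And>f \<epsilon>. continuous_on X f \<Longrightarrow> (\<And>x. x \<in> X \<Longrightarrow> f x \<in> {0..1}) \<Longrightarrow> \<epsilon> > 0 \<Longrightarrow>
       \<exists>g\<in>D. \<forall>x\<in>X. \<bar>g x - f x\<bar> < \<epsilon>"
    using countable_dense_unit_functions[OF compact_space] by blast
  define V where "V = (\<lambda>(g, m). {\<mu> \<in> MX. \<forall>n>0. 1 / real (Suc m) \<le> bavg_variance n g \<mu>})"
  define E where "E = V ` (D \<times> UNIV)"
  define A where "A = (\<lambda>k. MX - small_atoms k) ` UNIV"
  have "first_category_in WS (topspace WS - {\<mu> \<in> ergodic_measures X T. nonatomic_on X \<mu>})"
  proof (rule first_category_in_subset)
    show "countable (E \<union> A)" using D(1) by (simp add: E_def A_def)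
    show "nowhere_dense_in WS N" if N: "N \<in> E \<union> A" for N
    proof -
      consider g m where "g \<in> D" "N = {\<mu> \<in> MX. \<forall>n>0. 1 / real (Suc m) \<le> bavg_variance n g \<mu>}"
        | k where "N = MX - small_atoms k"
        using N unfolding E_def A_def V_def by (auto simp del: of_nat_Suc)
      then show ?thesis
      proof cases
        case 1
        have "continuous_on X g" by (rule continuous_on_subset[OF D(2)[OF 1(1)]]) simp
        then show ?thesis unfolding 1(2) by (rule nowhere_dense_variance[OF trans shadowing inf])
      next
        case 2
        then show ?thesis using nowhere_dense_large_atoms[OF trans shadowing inf] by simp
      qed
    qed
    show "topspace WS - {\<mu> \<in> ergodic_measures X T. nonatomic_on X \<mu>} \<subseteq> \<Union>(E \<union> A)"
    proof
      fix \<mu> assume "\<mu> \<in> topspace WS - {\<mu> \<in> ergodic_measures X T. nonatomic_on X \<mu>}"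
      then have \<mu>: "\<mu> \<in> MX" and "\<mu> \<notin> ergodic_measures X T \<or> \<not> nonatomic_on X \<mu>" by auto
      then show "\<mu> \<in> \<Union>(E \<union> A)"
      proof (elim disjE)
        assume "\<mu> \<notin> ergodic_measures X T"
        with \<mu> have "\<exists>g\<in>D. \<exists>m. \<forall>n>0. 1 / real (Suc m) \<le> bavg_variance n g \<mu>"
          by (rule nonergodic_variance) (fact D)+
        then obtain g m where "g \<in> D" "\<forall>n>0. 1 / real (Suc m) \<le> bavg_variance n g \<mu>" by blast
        then have "V (g, m) \<in> E" "\<mu> \<in> V (g, m)" using \<mu> by (auto simp: E_def V_def)
        then show ?thesis by blast
      next
        assume "\<not> nonatomic_on X \<mu>"
        then obtain x where x: "x \<in> X" "emeasure \<mu> {x} \<noteq> 0" unfolding nonatomic_on_def by blast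
        interpret prob_space \<mu> by (rule MX_D(1)[OF \<mu>])
        have "0 < measure \<mu> {x}" using x(2) by (simp add: emeasure_eq_measure zero_less_measure_iff)
        then obtain k where "1 / real (Suc k) < measure \<mu> {x}" by (rule nat_approx_posE)
        then have "\<mu> \<notin> small_atoms k" using measure_less_of_small_atoms[OF _ x(1)] by fastforce
        then show ?thesis using \<mu> by (auto simp: A_def)
      qed
    qed
  qed
  moreover have "ergodic_measures X T \<subseteq> MX" unfolding ergodic_measures_def by blast
  ultimately show ?thesis unfolding residual_in_def by auto
qed

end

theorem proposition3p7:
  fixes X :: "'a::metric_space set" and T :: "'a \<Rightarrow> 'a"
  assumes "dynamical_system X T"
    and "infinite X"
    and "transitive_system X T"
    and "shadowing_property X T"
  shows "residual_in (weak_star_topology X T)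
           {\<mu> \<in> ergodic_measures X T. nonatomic_on X \<mu>}"
proof -
  interpret compact_dynamics X T
    using assms(1) by unfold_locales (auto simp: dynamical_system_def)
  show ?thesis by (rule residual_nonatomic_ergodic[OF assms(3,4,2)])
qed

end
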